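(* Let $f:U\to\mathbb C$ be an eigenfunction for the Laplace-Beltrami operator of eigenvalue $\lambda$ (i.e. $-\Delta f=\lambda f$, $\lambda\in\mathbb C$) on an open subset $U\subseteq M$. Fix any $i_1,\dots,i_{2r}\in\{+,-\}$ such that $\#\{j:i_j=+\}=\#\{j:i_j=-\}=r$, where $r\in\mathbb Z_+$. 1. There exists a single-variable polynomial $P$ such that $$(\nabla^{2r}f)(h_{i_1}\otimes\cdots\otimes h_{i_{2r}})=P(\lambda)f.$$ 2. The roots of $P(\lambda)$ are contained in $\{q(q-1)K: q=1,\dots,r\}$. 3. If $i_{2r-t+1}=\cdots=i_{2r}$, then for every positive integer $q\le t$, $q(q-1)K$ is a root of $P(\lambda)$.
   Context: $M$ is a two-dimensional, connected, complete, orientable Riemannian manifold of constant sectional curvature $K\neq0$, with Levi-Civita connection $\nabla$ extended complex-linearly to $E=\mathbb C\otimes_{\mathbb R}TM$; $\Delta$ is the Laplace-Beltrami operator. Covariant derivatives are $(\nabla^nf)(Z_1,\dots,Z_n)=(\nabla_{Z_1}(\nabla^{n-1}f))(Z_2,\dots,Z_n)$, and $(\nabla^nf)(Z_1\otimes\cdots\otimes Z_n)$ means $(\nabla^nf)(Z_1,\dots,Z_n)$. Fix $p\in M$ and an orthonormal basis $e_1,e_2$ of $T_pM$ and let $h_\pm=e_1\mp\sqrt{-1}e_2\in E_p$. When the numbers of $+$ and $-$ among $i_1,\dots,i_k$ agree, $h_{i_1}\otimes\cdots\otimes h_{i_k}$ is the value at $p$ of a unique global parallel section of $E^{\otimes k}$,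 denoted by the same symbol. *)

theory Defs
  imports "HOL-Analysis.Analysis" "HOL-Computational_Algebra.Polynomial"
begin

section \<open>Smooth manifolds\<close>

text \<open>\<open>Ck k S f\<close>: \<open>f\<close> is \<open>k\<close> times continuously differentiable; only used for open \<open>S\<close>.\<close>

fun Ck :: "nat \<Rightarrow> 'v::euclidean_space set \<Rightarrow> ('v \<Rightarrow> 'w::real_normed_vector) \<Rightarrow> bool" where
  "Ck 0 S f \<longleftrightarrow> continuous_on S f"
| "Ck (Suc k) S f \<longleftrightarrow> (\<forall>x\<in>S. f differentiable (at x)) \<and>
     (\<forall>v. Ck k S (\<lambda>x. frechet_derivative f (at x) v))"

definition smooth_on :: "'v::euclidean_space set \<Rightarrow> ('v \<Rightarrow> 'w::real_normed_vector) \<Rightarrow> bool" where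
  "smooth_on S f \<longleftrightarrow> (\<forall>k. Ck k S f)"

text \<open>A chart is a domain together with a coordinate map; the values of the coordinate map
  outside the domain are irrelevant.\<close>

datatype ('a, 'n) chart = Chart (chart_dom: "'a set") (chart_map: "'a \<Rightarrow> real ^ 'n")

definition is_chart :: "'a topology \<Rightarrow> ('a, 'n::finite) chart \<Rightarrow> bool" where
  "is_chart M c \<longleftrightarrow> openin M (chart_dom c) \<and> open (chart_map c ` chart_dom c) \<and>
     homeomorphic_map (subtopology M (chart_dom c))
       (top_of_set (chart_map c ` chart_dom c)) (chart_map c)"

definition chart_inv :: "('a, 'n::finite) chart \<Rightarrow> real ^ 'n \<Rightarrow> 'a" where
  "chart_inv c = inv_into (chart_dom c) (chart_map c)"

definition transition :: "('a, 'n::finite) chart \<Rightarrow> ('a, 'n) chart \<Rightarrow> real ^ 'n \<Rightarrow> real ^ 'n" where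
  "transition c c' = chart_map c' \<circ> chart_inv c"

definition compatible :: "('a, 'n::finite) chart \<Rightarrow> ('a, 'n) chart \<Rightarrow> bool" where
  "compatible c c' \<longleftrightarrow>
     smooth_on (chart_map c ` (chart_dom c \<inter> chart_dom c')) (transition c c') \<and>
     smooth_on (chart_map c' ` (chart_dom c \<inter> chart_dom c')) (transition c' c)"

text \<open>\<open>A\<close> is the maximal atlas of a smooth structure on \<open>M\<close>.\<close>

definition smooth_manifold :: "'a topology \<Rightarrow> ('a, 'n::finite) chart set \<Rightarrow> bool" where
  "smooth_manifold M A \<longleftrightarrow>
     Hausdorff_space M \<and> second_countable M \<and>
     (\<forall>c\<in>A. is_chart M c) \<and> (\<Union>c\<in>A. chart_dom c) = topspace M \<and>
     (\<forall>c\<in>A. \<forall>c'\<in>A. compatible c c') \<and>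
     (\<forall>c. is_chart M c \<and> (\<forall>c'\<in>A. compatible c c') \<longrightarrow> c \<in> A)"

definition jac :: "('a, 'n::finite) chart \<Rightarrow> ('a, 'n) chart \<Rightarrow> 'a \<Rightarrow> real ^ 'n ^ 'n" where
  "jac c c' x = matrix (frechet_derivative (transition c c') (at (chart_map c x)))"

definition orientable :: "'a topology \<Rightarrow> ('a, 'n::finite) chart set \<Rightarrow> bool" where
  "orientable M A \<longleftrightarrow>
     (\<exists>B\<subseteq>A. (\<Union>c\<in>B. chart_dom c) = topspace M \<and>
        (\<forall>c\<in>B. \<forall>c'\<in>B. \<forall>x\<in>chart_dom c \<inter> chart_dom c'. det (jac c c' x) > 0))"

definition smooth_fun_on ::
  "('a, 'n::finite) chart set \<Rightarrow> 'a set \<Rightarrow> ('a \<Rightarrow> 'w::real_normed_vector) \<Rightarrow> bool" where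
  "smooth_fun_on A U f \<longleftrightarrow>
     (\<forall>c\<in>A. smooth_on (chart_map c ` (chart_dom c \<inter> U)) (f \<circ> chart_inv c))"

text \<open>The coordinate partial derivative \<open>\<partial>f/\<partial>x\<^sup>j\<close> at the point \<open>x\<close>.\<close>

definition pd :: "('a, 'n::finite) chart \<Rightarrow> 'n \<Rightarrow> ('a \<Rightarrow> 'w::real_normed_vector) \<Rightarrow> 'a \<Rightarrow> 'w" where
  "pd c j f x = frechet_derivative (f \<circ> chart_inv c) (at (chart_map c x)) (axis j 1)"


section \<open>Riemannian metrics and the Levi-Civita connection\<close>

text \<open>Tensors are given classically, by their components in each chart, subject to the
  transformation law under change of charts. Component values in charts whose domain does not
  contain the base point are irrelevant.\<close>

type_synonym ('a, 'n) tvec = "('a, 'n) chart \<Rightarrow> real ^ 'n"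
type_synonym ('a, 'n) metric = "('a, 'n) chart \<Rightarrow> 'a \<Rightarrow> real ^ 'n ^ 'n"

definition tangent_vector :: "('a, 'n::finite) chart set \<Rightarrow> 'a \<Rightarrow> ('a, 'n) tvec \<Rightarrow> bool" where
  "tangent_vector A x v \<longleftrightarrow>
     (\<forall>c\<in>A. \<forall>c'\<in>A. x \<in> chart_dom c \<inter> chart_dom c' \<longrightarrow> v c' = jac c c' x *v v c)"

definition gip :: "('a, 'n::finite) metric \<Rightarrow> ('a, 'n) chart \<Rightarrow> 'a \<Rightarrow> real ^ 'n \<Rightarrow> real ^ 'n \<Rightarrow> real" where
  "gip g c x u v = (\<Sum>i\<in>UNIV. \<Sum>j\<in>UNIV. g c x $ i $ j * u $ i * v $ j)"

definition riemannian_manifold ::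
  "'a topology \<Rightarrow> ('a, 'n::finite) chart set \<Rightarrow> ('a, 'n) metric \<Rightarrow> bool" where
  "riemannian_manifold M A g \<longleftrightarrow> smooth_manifold M A \<and>
     (\<forall>c\<in>A. smooth_on (chart_map c ` chart_dom c) (g c \<circ> chart_inv c)) \<and>
     (\<forall>c\<in>A. \<forall>x\<in>chart_dom c. transpose (g c x) = g c x \<and> (\<forall>v. v \<noteq> 0 \<longrightarrow> gip g c x v v > 0)) \<and>
     (\<forall>c\<in>A. \<forall>c'\<in>A. \<forall>x\<in>chart_dom c \<inter> chart_dom c'.
        g c x = transpose (jac c c' x) ** g c' x ** jac c c' x)"

definition orthonormal_basis ::
  "('a, 'n::finite) chart set \<Rightarrow> ('a, 'n) metric \<Rightarrow> 'a \<Rightarrow> ('n \<Rightarrow> ('a, 'n) tvec) \<Rightarrow> bool" where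
  "orthonormal_basis A g x e \<longleftrightarrow> (\<forall>i. tangent_vector A x (e i)) \<and>
     (\<forall>c\<in>A. x \<in> chart_dom c \<longrightarrow> (\<forall>i j. gip g c x (e i c) (e j c) = (if i = j then 1 else 0)))"

definition ginv :: "('a, 'n::finite) metric \<Rightarrow> ('a, 'n) chart \<Rightarrow> 'a \<Rightarrow> 'n \<Rightarrow> 'n \<Rightarrow> real" where
  "ginv g c x i j = matrix_inv (g c x) $ i $ j"

text \<open>\<open>christoffel g c x k i j\<close> is \<open>\<Gamma>\<^sup>k\<^sub>i\<^sub>j\<close>, i.e. \<open>\<nabla>\<^sub>\<partial>\<^sub>i \<partial>\<^sub>j = \<Sum>k. \<Gamma>\<^sup>k\<^sub>i\<^sub>j \<partial>\<^sub>k\<close> for the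
  Levi-Civita connection.\<close>

definition christoffel ::
  "('a, 'n::finite) metric \<Rightarrow> ('a, 'n) chart \<Rightarrow> 'a \<Rightarrow> 'n \<Rightarrow> 'n \<Rightarrow> 'n \<Rightarrow> real" where
  "christoffel g c x k i j = (1/2) * (\<Sum>l\<in>UNIV. ginv g c x k l *
     (pd c i (\<lambda>y. g c y $ j $ l) x + pd c j (\<lambda>y. g c y $ i $ l) x - pd c l (\<lambda>y. g c y $ i $ j) x))"

text \<open>\<open>riemann g c x l i j k\<close> is the \<open>l\<close>-th component of \<open>R(\<partial>\<^sub>i, \<partial>\<^sub>j) \<partial>\<^sub>k\<close>, where
  \<open>R(X, Y) Z = \<nabla>\<^sub>X \<nabla>\<^sub>Y Z - \<nabla>\<^sub>Y \<nabla>\<^sub>X Z - \<nabla>\<^bsub>[X, Y]\<^esub> Z\<close>.\<close>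

definition riemann ::
  "('a, 'n::finite) metric \<Rightarrow> ('a, 'n) chart \<Rightarrow> 'a \<Rightarrow> 'n \<Rightarrow> 'n \<Rightarrow> 'n \<Rightarrow> 'n \<Rightarrow> real" where
  "riemann g c x l i j k =
     pd c i (\<lambda>y. christoffel g c y l j k) x - pd c j (\<lambda>y. christoffel g c y l i k) x +
     (\<Sum>m\<in>UNIV. christoffel g c x m j k * christoffel g c x l i m
              - christoffel g c x m i k * christoffel g c x l j m)"

definition curv_op ::
  "('a, 'n::finite) metric \<Rightarrow> ('a, 'n) chart \<Rightarrow> 'a \<Rightarrow> real ^ 'n \<Rightarrow> real ^ 'n \<Rightarrow> real ^ 'n \<Rightarrow> real ^ 'n" where
  "curv_op g c x u v w =
     (\<chi> l. \<Sum>i\<in>UNIV. \<Sum>j\<in>UNIV. \<Sum>k\<in>UNIV. riemann g c x l i j k * u $ i * v $ j * w $ k)"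

definition sectional_curvature ::
  "('a, 'n::finite) metric \<Rightarrow> ('a, 'n) chart \<Rightarrow> 'a \<Rightarrow> real ^ 'n \<Rightarrow> real ^ 'n \<Rightarrow> real" where
  "sectional_curvature g c x u v = gip g c x (curv_op g c x u v v) u /
     (gip g c x u u * gip g c x v v - (gip g c x u v)\<^sup>2)"

definition constant_sectional_curvature ::
  "('a, 'n::finite) chart set \<Rightarrow> ('a, 'n) metric \<Rightarrow> real \<Rightarrow> bool" where
  "constant_sectional_curvature A g K \<longleftrightarrow>
     (\<forall>c\<in>A. \<forall>x\<in>chart_dom c. \<forall>u v. u \<noteq> v \<and> independent {u, v} \<longrightarrow>
        sectional_curvature g c x u v = K)"

text \<open>In the chart \<open>c\<close>, the function \<open>V\<close> below is the velocity of \<open>\<gamma>\<close> at those times at which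
  \<open>\<gamma>\<close> lies in the domain of \<open>c\<close>.\<close>

definition geodesic ::
  "'a topology \<Rightarrow> ('a, 'n::finite) chart set \<Rightarrow> ('a, 'n) metric \<Rightarrow> (real \<Rightarrow> 'a) \<Rightarrow> bool" where
  "geodesic M A g \<gamma> \<longleftrightarrow> continuous_map euclideanreal M \<gamma> \<and>
     (\<forall>c\<in>A. \<exists>V. \<forall>t. \<gamma> t \<in> chart_dom c \<longrightarrow>
        ((chart_map c \<circ> \<gamma>) has_vector_derivative V t) (at t) \<and>
        (V has_vector_derivative
          (\<chi> k. - (\<Sum>i\<in>UNIV. \<Sum>j\<in>UNIV. christoffel g c (\<gamma> t) k i j * V t $ i * V t $ j))) (at t))"

text \<open>Completeness is geodesic completeness: every tangent vector is the initial velocity of a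
  geodesic defined on all of the real line.\<close>

definition complete_manifold ::
  "'a topology \<Rightarrow> ('a, 'n::finite) chart set \<Rightarrow> ('a, 'n) metric \<Rightarrow> bool" where
  "complete_manifold M A g \<longleftrightarrow>
     (\<forall>x\<in>topspace M. \<forall>v. tangent_vector A x v \<longrightarrow>
        (\<exists>\<gamma>. geodesic M A g \<gamma> \<and> \<gamma> 0 = x \<and>
           (\<forall>c\<in>A. x \<in> chart_dom c \<longrightarrow> ((chart_map c \<circ> \<gamma>) has_vector_derivative v c) (at 0))))"


section \<open>Covariant derivatives of functions and the Laplace-Beltrami operator\<close>

text \<open>A complex tensor of rank \<open>k\<close> has components indexed by lists of length \<open>k\<close>.
  For a covariant tensor field \<open>T\<close> of rank \<open>k\<close>, \<open>cov_deriv\<close> gives the components of \<open>\<nabla>T\<close>; the head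
  of the index list is the direction of differentiation, so that
  \<open>(\<nabla>T)(Z\<^sub>0, Z\<^sub>1, \<dots>, Z\<^sub>k) = (\<nabla>\<^bsub>Z\<^sub>0\<^esub> T)(Z\<^sub>1, \<dots>, Z\<^sub>k)\<close>. The value on the empty list is
  irrelevant.\<close>

definition cov_deriv ::
  "('a, 'n::finite) metric \<Rightarrow> ('a, 'n) chart \<Rightarrow> ('a \<Rightarrow> 'n list \<Rightarrow> complex) \<Rightarrow> 'a \<Rightarrow> 'n list \<Rightarrow> complex" where
  "cov_deriv g c T x js = (case js of [] \<Rightarrow> 0 | j # is \<Rightarrow>
     pd c j (\<lambda>y. T y is) x -
     (\<Sum>m<length is. \<Sum>a\<in>UNIV. of_real (christoffel g c x a j (is ! m)) * T x (is[m := a])))"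

definition nabla_fun ::
  "('a, 'n::finite) metric \<Rightarrow> ('a, 'n) chart \<Rightarrow> nat \<Rightarrow> ('a \<Rightarrow> complex) \<Rightarrow> 'a \<Rightarrow> 'n list \<Rightarrow> complex" where
  "nabla_fun g c n f = (cov_deriv g c ^^ n) (\<lambda>x _. f x)"

definition grad ::
  "('a, 'n::finite) metric \<Rightarrow> ('a, 'n) chart \<Rightarrow> ('a \<Rightarrow> complex) \<Rightarrow> 'a \<Rightarrow> 'n \<Rightarrow> complex" where
  "grad g c f x i = (\<Sum>j\<in>UNIV. of_real (ginv g c x i j) * pd c j f x)"

text \<open>The divergence of \<open>X\<close> is the trace of \<open>Z \<mapsto> \<nabla>\<^sub>Z X\<close>.\<close>

definition divergence ::
  "('a, 'n::finite) metric \<Rightarrow> ('a, 'n) chart \<Rightarrow> ('a \<Rightarrow> 'n \<Rightarrow> complex) \<Rightarrow> 'a \<Rightarrow> complex" where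
  "divergence g c X x =
     (\<Sum>i\<in>UNIV. pd c i (\<lambda>y. X y i) x + (\<Sum>k\<in>UNIV. of_real (christoffel g c x i i k) * X x k))"

definition laplacian ::
  "('a, 'n::finite) metric \<Rightarrow> ('a, 'n) chart \<Rightarrow> ('a \<Rightarrow> complex) \<Rightarrow> 'a \<Rightarrow> complex" where
  "laplacian g c f = divergence g c (grad g c f)"

definition eigenfunction ::
  "('a, 'n::finite) chart set \<Rightarrow> ('a, 'n) metric \<Rightarrow> 'a set \<Rightarrow> complex \<Rightarrow> ('a \<Rightarrow> complex) \<Rightarrow> bool" where
  "eigenfunction A g U \<mu> f \<longleftrightarrow> smooth_fun_on A U f \<and>
     (\<forall>c\<in>A. \<forall>x\<in>chart_dom c \<inter> U. - laplacian g c f x = \<mu> * f x)"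


section \<open>Parallel sections of tensor powers of the complexified tangent bundle\<close>

type_synonym ('a, 'n) ctensor = "('a, 'n) chart \<Rightarrow> 'n list \<Rightarrow> complex"
type_synonym ('a, 'n) ctensor_field = "('a, 'n) chart \<Rightarrow> 'a \<Rightarrow> 'n list \<Rightarrow> complex"

text \<open>Smooth global sections of \<open>E\<^sup>\<otimes>\<^sup>k\<close>, where \<open>E\<close> is the complexified tangent bundle.\<close>

definition smooth_section ::
  "('a, 'n::finite) chart set \<Rightarrow> nat \<Rightarrow> ('a, 'n) ctensor_field \<Rightarrow> bool" where
  "smooth_section A k S \<longleftrightarrow>
     (\<forall>c\<in>A. \<forall>js. length js = k \<longrightarrow>
        smooth_on (chart_map c ` chart_dom c) ((\<lambda>x. S c x js) \<circ> chart_inv c)) \<and>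
     (\<forall>c\<in>A. \<forall>c'\<in>A. \<forall>x\<in>chart_dom c \<inter> chart_dom c'. \<forall>js. length js = k \<longrightarrow>
        S c' x js = (\<Sum>ks | length ks = k.
          (\<Prod>m<k. of_real (jac c c' x $ (js ! m) $ (ks ! m))) * S c x ks))"

text \<open>The second condition says \<open>\<nabla>\<^bsub>\<partial>\<^sub>j\<^esub> S = 0\<close> for every coordinate vector field.\<close>

definition parallel_section ::
  "('a, 'n::finite) chart set \<Rightarrow> ('a, 'n) metric \<Rightarrow> nat \<Rightarrow> ('a, 'n) ctensor_field \<Rightarrow> bool" where
  "parallel_section A g k S \<longleftrightarrow> smooth_section A k S \<and>
     (\<forall>c\<in>A. \<forall>x\<in>chart_dom c. \<forall>j js. length js = k \<longrightarrow>
        pd c j (\<lambda>y. S c y js) x +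
        (\<Sum>m<k. \<Sum>a\<in>UNIV. of_real (christoffel g c x (js ! m) j a) * S c x (js[m := a])) = 0)"

definition contract ::
  "nat \<Rightarrow> ('n list \<Rightarrow> complex) \<Rightarrow> ('n::finite list \<Rightarrow> complex) \<Rightarrow> complex" where
  "contract k T S = (\<Sum>js | length js = k. T js * S js)"

datatype sign = Plus | Minus

definition hvec :: "(2 \<Rightarrow> ('a, 2) tvec) \<Rightarrow> sign \<Rightarrow> ('a, 2) chart \<Rightarrow> complex ^ 2" where
  "hvec e s c = (\<chi> j. case s of
      Plus \<Rightarrow> of_real (e 1 c $ j) - \<i> * of_real (e 2 c $ j)
    | Minus \<Rightarrow> of_real (e 1 c $ j) + \<i> * of_real (e 2 c $ j))"

text \<open>The tensor \<open>h\<^bsub>i\<^sub>1\<^esub> \<otimes> \<dots> \<otimes> h\<^bsub>i\<^sub>k\<^esub>\<close> at the base point of the basis \<open>e\<close>.\<close>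

definition htensor :: "(2 \<Rightarrow> ('a, 2) tvec) \<Rightarrow> sign list \<Rightarrow> ('a, 2) ctensor" where
  "htensor e is c js = (\<Prod>m<length is. hvec e (is ! m) c $ (js ! m))"

text \<open>\<open>S\<close> is a global parallel section of \<open>E\<^sup>\<otimes>\<^sup>k\<close> with value \<open>h\<^bsub>i\<^sub>1\<^esub> \<otimes> \<dots> \<otimes> h\<^bsub>i\<^sub>k\<^esub>\<close> at \<open>p\<close>.\<close>

definition parallel_extension ::
  "('a, 2) chart set \<Rightarrow> ('a, 2) metric \<Rightarrow> 'a \<Rightarrow> (2 \<Rightarrow> ('a, 2) tvec) \<Rightarrow> sign list \<Rightarrow>
    ('a, 2) ctensor_field \<Rightarrow> bool" where
  "parallel_extension A g p e is S \<longleftrightarrow> parallel_section A g (length is) S \<and>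
     (\<forall>c\<in>A. p \<in> chart_dom c \<longrightarrow> (\<forall>js. length js = length is \<longrightarrow> S c p js = htensor e is c js))"

end

theory Submission
  imports Defs
begin

text \<open>
  Over a chart choose a null frame: complex vector fields \<open>h\<^sub>+\<close>, \<open>h\<^sub>-\<close> with
  \<open>g(h\<^sub>+, h\<^sub>+) = g(h\<^sub>-, h\<^sub>-) = 0\<close> and \<open>g(h\<^sub>+, h\<^sub>-) = 2\<close>. Metric compatibility forces
  \<open>\<nabla>h\<^sub>\<plusminus> = \<plusminus>\<Omega> h\<^sub>\<plusminus>\<close>, and \<open>d\<Omega>(h\<^sub>+, h\<^sub>-) = 2K\<close>. Hence the functions
  \<open>W(i\<^sub>1\<dots>i\<^sub>k) = (\<nabla>\<^sup>k f)(h\<^sub>i\<^sub>1, \<dots>, h\<^sub>i\<^sub>k)\<close> obey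
  \<open>W(-, +, I) = W(+, -, I) + 2 w K W(I)\<close>, where \<open>w\<close> is the number of \<open>+\<close> minus
  the number of \<open>-\<close> in \<open>I\<close>, and \<open>W(+, -) = \<Delta>f\<close>. Writing \<open>W\<^sub>q\<close> for \<open>W(+, \<dots>, +)\<close> with
  \<open>q\<close> signs, induction gives \<open>W(-, +, \<dots>, +) = (q(q - 1)K - \<lambda>) W\<^bsub>q-1\<^esub>\<close> when there are \<open>q\<close>
  plus signs, and symmetrically with the signs exchanged. Reading a word from the right, each step that
  moves its weight from \<open>\<plusminus>q\<close> towards \<open>0\<close> contributes the factor \<open>q(q - 1)K - \<lambda>\<close> to \<open>P\<close>.

  The parallel section agrees everywhere with \<open>h\<^sub>i\<^sub>1 \<otimes> \<dots> \<otimes> h\<^sub>i\<^sub>k\<close> for some null frame: a null pair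
  at a point is unique up to reciprocal scaling and exchange, a frame tensor of weight \<open>0\<close> is parallel
  and unaffected by the scaling, parallel tensors on a convex chart neighbourhood are determined by one value,
  and \<open>M\<close> is connected.
\<close>

section \<open>Calculus of smooth functions\<close>

lemma Ck_cong:
  assumes "open S" "\<And>x. x \<in> S \<Longrightarrow> f x = g x" "Ck k S f"
  shows "Ck k S g"
  using assms(2,3)
proof (induction k arbitrary: f g)
  case 0
  then show ?case by (simp cong: continuous_on_cong)
next
  case (Suc k)
  have d: "g differentiable (at x)" if "x \<in> S" for x
    using Suc.prems that
    by (metis Ck.simps(2) assms(1) differentiable_def has_derivative_transform_within_open)
  have e: "frechet_derivative f (at x) = frechet_derivative g (at x)" if "x \<in> S" for x
    by (rule frechet_derivative_transform_within_open[OF _ assms(1) that Suc.prems(1)])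
      (use Suc.prems(2) that in auto)
  have "Ck k S (\<lambda>x. frechet_derivative g (at x) v)" for v
    by (rule Suc.IH[of "\<lambda>x. frechet_derivative f (at x) v"]) (use Suc.prems(2) e in auto)
  with d show ?case by simp
qed

lemma Ck_subset: "T \<subseteq> S \<Longrightarrow> Ck k S f \<Longrightarrow> Ck k T f"
  by (induction k arbitrary: f) (auto intro: continuous_on_subset)

lemma Ck_Suc_imp: "Ck (Suc k) S f \<Longrightarrow> Ck k S f"
proof (induction k arbitrary: f)
  case 0
  then show ?case
    by (auto intro!: continuous_at_imp_continuous_on differentiable_imp_continuous_within)
next
  case (Suc k)
  then show ?case by (metis Ck.simps(2))
qed

text \<open>\<open>Ck\<close> is phrased through \<open>frechet_derivative\<close>; uniqueness of
  derivatives lets any explicit formula valid on the open set replace it, and the closure rules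
  below rest on this.\<close>

lemma Ck_SucI:
  assumes "open S" "\<And>x. x \<in> S \<Longrightarrow> (f has_derivative f' x) (at x)" "\<And>v. Ck k S (\<lambda>x. f' x v)"
  shows "Ck (Suc k) S f"
proof -
  have "f' x = frechet_derivative f (at x)" if "x \<in> S" for x
    using assms(2)[OF that] frechet_derivative_at by blast
  then have "Ck k S (\<lambda>x. frechet_derivative f (at x) v)" for v
    using Ck_cong[OF assms(1) _ assms(3)[of v]] by simp
  then show ?thesis
    using assms(2) by (auto simp: differentiable_def)
qed

lemma Ck_SucD:
  "Ck (Suc k) S f \<Longrightarrow> x \<in> S \<Longrightarrow> (f has_derivative frechet_derivative f (at x)) (at x)"
  by (simp add: frechet_derivative_works)

lemma Ck_const: "open S \<Longrightarrow> Ck k S (\<lambda>x. c)"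
proof (induction k arbitrary: c)
  case (Suc k)
  then show ?case by (intro Ck_SucI[where f' = "\<lambda>x v. 0"]) auto
qed simp

lemma Ck_bounded_linear:
  assumes "open S" "bounded_linear L" "Ck k S f"
  shows "Ck k S (\<lambda>x. L (f x))"
  using assms(3)
proof (induction k arbitrary: f)
  case 0
  then show ?case by (auto intro: bounded_linear.continuous_on[OF assms(2)])
next
  case (Suc k)
  show ?case
  proof (rule Ck_SucI[OF assms(1)])
    show "((\<lambda>x. L (f x)) has_derivative (\<lambda>v. L (frechet_derivative f (at x) v))) (at x)"
      if "x \<in> S" for x
      using bounded_linear.has_derivative[OF assms(2) Ck_SucD[OF Suc.prems that]] .
    show "Ck k S (\<lambda>x. L (frechet_derivative f (at x) v))" for v
      using Suc by simp
  qed
qed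

lemma Ck_add:
  assumes "open S" "Ck k S f" "Ck k S g"
  shows "Ck k S (\<lambda>x. f x + g x)"
  using assms(2,3)
proof (induction k arbitrary: f g)
  case 0
  then show ?case by (auto intro: continuous_intros)
next
  case (Suc k)
  show ?case
    using Suc by (intro Ck_SucI[OF assms(1) has_derivative_add[OF Ck_SucD Ck_SucD]]) auto
qed

lemma Ck_mult:
  fixes f g :: "'v::euclidean_space \<Rightarrow> 'w::real_normed_algebra"
  assumes "open S" "Ck k S f" "Ck k S g"
  shows "Ck k S (\<lambda>x. f x * g x)"
  using assms(2,3)
proof (induction k arbitrary: f g)
  case 0
  then show ?case by (auto intro: continuous_intros)
next
  case (Suc k)
  show ?case
    using Suc Suc.prems[THEN Ck_Suc_imp]
    by (intro Ck_SucI[OF assms(1) has_derivative_mult[OF Ck_SucD Ck_SucD]] Ck_add[OF assms(1)]) auto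
qed

text \<open>The derivative of the inverse is built from the inverse itself and the derivative of
  \<open>f\<close>, so regularity of order \<open>k\<close> of the inverse feeds order
  \<open>Suc k\<close>. \<open>Ck_sqrt\<close> bootstraps in the same way.\<close>

lemma Ck_inverse:
  fixes f :: "'v::euclidean_space \<Rightarrow> 'w::real_normed_div_algebra"
  assumes "open S" "\<And>x. x \<in> S \<Longrightarrow> f x \<noteq> 0" "Ck k S f"
  shows "Ck k S (\<lambda>x. inverse (f x))"
  using assms(3)
proof (induction k)
  case 0
  then show ?case using assms(2) by (auto intro: continuous_intros)
next
  case (Suc k)
  have m: "Ck k S (\<lambda>x. inverse (f x))"
    using Suc Ck_Suc_imp by blast
  have n: "Ck k S (\<lambda>x. - (inverse (f x) * frechet_derivative f (at x) v * inverse (f x)))" for v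
    using Suc.prems m
    by (intro Ck_bounded_linear[OF assms(1) bounded_linear_minus[OF bounded_linear_ident]]
        Ck_mult[OF assms(1)]) auto
  show ?case
    using assms(2) n by (intro Ck_SucI[OF assms(1) Deriv.has_derivative_inverse[OF _ Ck_SucD[OF Suc.prems]]]) auto
qed

lemma Ck_sqrt:
  fixes f :: "'v::euclidean_space \<Rightarrow> real"
  assumes "open S" "\<And>x. x \<in> S \<Longrightarrow> f x > 0" "Ck k S f"
  shows "Ck k S (\<lambda>x. sqrt (f x))"
  using assms(3)
proof (induction k)
  case 0
  then show ?case by (auto intro: continuous_intros)
next
  case (Suc k)
  have m: "Ck k S (\<lambda>x. sqrt (f x))"
    using Suc Ck_Suc_imp by blast
  have i: "Ck k S (\<lambda>x. inverse (2 * sqrt (f x)))"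
    using assms(2) by (intro Ck_inverse Ck_mult m Ck_const assms(1)) (use assms(2) in force)+
  show ?case
  proof (rule Ck_SucI[OF assms(1)])
    show "((\<lambda>x. sqrt (f x)) has_derivative
        (\<lambda>v. frechet_derivative f (at x) v * inverse (2 * sqrt (f x)))) (at x)" if "x \<in> S" for x
      using assms(2)[OF that]
      by (auto intro!: derivative_eq_intros Ck_SucD[OF Suc.prems that] simp: field_simps)
    show "Ck k S (\<lambda>x. frechet_derivative f (at x) v * inverse (2 * sqrt (f x)))" for v
      using Suc.prems by (intro Ck_mult i assms(1)) auto
  qed
qed

lemma smooth_on_imp_has_derivative:
  "smooth_on S f \<Longrightarrow> x \<in> S \<Longrightarrow> (f has_derivative frechet_derivative f (at x)) (at x)"
  unfolding smooth_on_def by (metis Ck_SucD)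

lemma smooth_on_frechet_derivative:
  "smooth_on S f \<Longrightarrow> smooth_on S (\<lambda>x. frechet_derivative f (at x) v)"
  unfolding smooth_on_def by (metis Ck.simps(2))

lemma smooth_on_imp_continuous_on: "smooth_on S f \<Longrightarrow> continuous_on S f"
  unfolding smooth_on_def by (metis Ck.simps(1))

section \<open>Symmetry of mixed second derivatives\<close>

text \<open>Two uses of the mean value theorem, first along \<open>v\<close> and then along
  \<open>w\<close>, turn the quotient into the mixed derivative at a nearby point; continuity of
  that derivative finishes.\<close>

lemma second_difference_quotient:
  fixes f :: "'v::euclidean_space \<Rightarrow> real"
  assumes "open S" "smooth_on S f" "y \<in> S" "0 < \<epsilon>"
  shows "\<exists>\<delta>>0. \<forall>h. 0 < h \<and> h < \<delta> \<longrightarrow>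
    \<bar>(f (y + h *\<^sub>R v + h *\<^sub>R w) - f (y + h *\<^sub>R v) - f (y + h *\<^sub>R w) + f y) / h\<^sup>2 -
       frechet_derivative (\<lambda>x. frechet_derivative f (at x) v) (at y) w\<bar> < \<epsilon>"
proof -
  define D where "D = (\<lambda>x. frechet_derivative f (at x) v)"
  define E where "E = (\<lambda>x. frechet_derivative D (at x) w)"
  have D: "smooth_on S D" and E: "smooth_on S E"
    unfolding E_def D_def using assms(2) by (auto intro: smooth_on_frechet_derivative)
  obtain d1 where d1: "d1 > 0" "ball y d1 \<subseteq> S"
    using assms openE by blast
  have "isCont E y"
    using smooth_on_imp_continuous_on[OF E] assms(1,3) by (simp add: continuous_on_eq_continuous_at)
  then obtain d2 where d2: "d2 > 0" "\<And>x. dist x y < d2 \<Longrightarrow> dist (E x) (E y) < \<epsilon>"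
    unfolding continuous_at_eps_delta using assms(4) by blast
  \<comment> \<open>The summand 1 keeps \<open>N\<close> positive when \<open>v\<close> and
    \<open>w\<close> both vanish. With \<delta> below, the whole parallelogram spanned by
    \<open>h v\<close> and \<open>h w\<close> stays in both balls around \<open>y\<close>.\<close>
  define N where "N = norm v + norm w + 1"
  have N: "N > 0" unfolding N_def by (simp add: add_nonneg_pos)
  define \<delta> where "\<delta> = min d1 d2 / N"
  have "\<delta> > 0" using d1 d2 N by (simp add: \<delta>_def)
  moreover have "\<bar>(f (y + h *\<^sub>R v + h *\<^sub>R w) - f (y + h *\<^sub>R v) - f (y + h *\<^sub>R w) + f y) / h\<^sup>2 - E y\<bar> < \<epsilon>"
    if h: "0 < h" "h < \<delta>" for h
  proof -
    have near: "dist (y + a *\<^sub>R v + b *\<^sub>R w) y < min d1 d2"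
      if "0 \<le> a" "a \<le> h" "0 \<le> b" "b \<le> h" for a b
    proof -
      have "dist (y + a *\<^sub>R v + b *\<^sub>R w) y \<le> a * norm v + b * norm w"
        using norm_triangle_ineq[of "a *\<^sub>R v" "b *\<^sub>R w"] that by (simp add: dist_norm algebra_simps)
      also have "\<dots> \<le> h * norm v + h * norm w"
        using that by (intro add_mono mult_right_mono) auto
      also have "\<dots> < h * N" using h by (simp add: N_def algebra_simps)
      also have "\<dots> < min d1 d2" using h N by (simp add: \<delta>_def pos_less_divide_eq)
      finally show ?thesis .
    qed
    then have inS: "y + a *\<^sub>R v + b *\<^sub>R w \<in> S"
      if "0 \<le> a" "a \<le> h" "0 \<le> b" "b \<le> h" for a b
      using that d1 by (metis dist_commute mem_ball min_less_iff_conj subsetD)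
    define \<phi> where "\<phi> = (\<lambda>a. f (y + a *\<^sub>R v + h *\<^sub>R w) - f (y + a *\<^sub>R v))"
    have der_f: "((\<lambda>a. f (y + a *\<^sub>R v + b *\<^sub>R w)) has_real_derivative D (y + a *\<^sub>R v + b *\<^sub>R w)) (at a)"
      if "0 \<le> a" "a \<le> h" "0 \<le> b" "b \<le> h" for a b
    proof -
      note fd = smooth_on_imp_has_derivative[OF assms(2) inS[OF that]]
      have "((\<lambda>a. y + a *\<^sub>R v + b *\<^sub>R w) has_derivative (\<lambda>t. t *\<^sub>R v)) (at a)"
        by (auto intro!: derivative_eq_intros)
      from has_derivative_compose[OF this fd] linear_cmul[OF has_derivative_linear[OF fd]]
      show ?thesis by (simp add: has_field_derivative_def D_def mult_commute_abs)
    qed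
    have der_\<phi>: "(\<phi> has_real_derivative D (y + a *\<^sub>R v + h *\<^sub>R w) - D (y + a *\<^sub>R v)) (at a)"
      if "0 \<le> a" "a \<le> h" for a
      using der_f[OF that, of h] der_f[OF that, of 0] h unfolding \<phi>_def by (auto intro!: DERIV_diff)
    obtain \<xi> where \<xi>: "0 < \<xi>" "\<xi> < h"
      "\<phi> h - \<phi> 0 = (h - 0) * (D (y + \<xi> *\<^sub>R v + h *\<^sub>R w) - D (y + \<xi> *\<^sub>R v))"
      using MVT2[of 0 h \<phi> "\<lambda>a. D (y + a *\<^sub>R v + h *\<^sub>R w) - D (y + a *\<^sub>R v)"] h der_\<phi> by auto
    have der_D: "((\<lambda>b. D (y + \<xi> *\<^sub>R v + b *\<^sub>R w)) has_real_derivative E (y + \<xi> *\<^sub>R v + b *\<^sub>R w)) (at b)"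
      if "0 \<le> b" "b \<le> h" for b
    proof -
      note fd = smooth_on_imp_has_derivative[OF D inS[of \<xi> b]]
      have "((\<lambda>b. y + \<xi> *\<^sub>R v + b *\<^sub>R w) has_derivative (\<lambda>t. t *\<^sub>R w)) (at b)"
        by (auto intro!: derivative_eq_intros)
      from has_derivative_compose[OF this fd] linear_cmul[OF has_derivative_linear[OF fd]]
      show ?thesis using that \<xi> by (simp add: has_field_derivative_def E_def mult_commute_abs)
    qed
    obtain \<eta> where \<eta>: "0 < \<eta>" "\<eta> < h"
      "D (y + \<xi> *\<^sub>R v + h *\<^sub>R w) - D (y + \<xi> *\<^sub>R v + 0 *\<^sub>R w) = (h - 0) * E (y + \<xi> *\<^sub>R v + \<eta> *\<^sub>R w)"
      using MVT2[of 0 h "\<lambda>b. D (y + \<xi> *\<^sub>R v + b *\<^sub>R w)" "\<lambda>b. E (y + \<xi> *\<^sub>R v + b *\<^sub>R w)"] h der_D by auto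
    have "f (y + h *\<^sub>R v + h *\<^sub>R w) - f (y + h *\<^sub>R v) - f (y + h *\<^sub>R w) + f y = \<phi> h - \<phi> 0"
      by (simp add: \<phi>_def)
    also have "\<dots> = h\<^sup>2 * E (y + \<xi> *\<^sub>R v + \<eta> *\<^sub>R w)"
      using \<xi>(3) \<eta>(3) by (simp add: power2_eq_square)
    finally have "(f (y + h *\<^sub>R v + h *\<^sub>R w) - f (y + h *\<^sub>R v) - f (y + h *\<^sub>R w) + f y) / h\<^sup>2 =
        E (y + \<xi> *\<^sub>R v + \<eta> *\<^sub>R w)"
      using h by simp
    then show ?thesis
      using d2(2)[of "y + \<xi> *\<^sub>R v + \<eta> *\<^sub>R w"] near[of \<xi> \<eta>] \<xi> \<eta> by (simp add: dist_real_def)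
  qed
  ultimately show ?thesis unfolding E_def D_def by blast
qed

text \<open>The second difference is symmetric in \<open>v\<close> and \<open>w\<close>, and both
  iterated derivatives are its limit; a tolerance of half the supposed gap gives the
  contradiction.\<close>

lemma symmetric_second_derivative_real:
  fixes f :: "'v::euclidean_space \<Rightarrow> real"
  assumes "open S" "smooth_on S f" "y \<in> S"
  shows "frechet_derivative (\<lambda>x. frechet_derivative f (at x) v) (at y) w =
         frechet_derivative (\<lambda>x. frechet_derivative f (at x) w) (at y) v" (is "?a = ?b")
proof (rule ccontr)
  assume "?a \<noteq> ?b"
  then have e: "\<bar>?a - ?b\<bar> / 2 > 0" by simp
  obtain d1 where d1: "d1 > 0" "\<And>h. 0 < h \<Longrightarrow> h < d1 \<Longrightarrow>
    \<bar>(f (y + h *\<^sub>R v + h *\<^sub>R w) - f (y + h *\<^sub>R v) - f (y + h *\<^sub>R w) + f y) / h\<^sup>2 - ?a\<bar> < \<bar>?a - ?b\<bar> / 2"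
    using second_difference_quotient[OF assms e, of v w] by blast
  obtain d2 where d2: "d2 > 0" "\<And>h. 0 < h \<Longrightarrow> h < d2 \<Longrightarrow>
    \<bar>(f (y + h *\<^sub>R w + h *\<^sub>R v) - f (y + h *\<^sub>R w) - f (y + h *\<^sub>R v) + f y) / h\<^sup>2 - ?b\<bar> < \<bar>?a - ?b\<bar> / 2"
    using second_difference_quotient[OF assms e, of w v] by blast
  define h where "h = min d1 d2 / 2"
  have h: "0 < h" "h < d1" "h < d2" using d1(1) d2(1) by (auto simp: h_def)
  have eq: "f (y + h *\<^sub>R w + h *\<^sub>R v) - f (y + h *\<^sub>R w) - f (y + h *\<^sub>R v) + f y =
    f (y + h *\<^sub>R v + h *\<^sub>R w) - f (y + h *\<^sub>R v) - f (y + h *\<^sub>R w) + f y"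
    by (simp add: add.assoc add.commute[of "h *\<^sub>R w"])
  have "\<bar>a - b\<bar> \<le> \<bar>q - a\<bar> + \<bar>q - b\<bar>" for a b q :: real
    by arith
  from add_strict_mono[OF d1(2)[OF h(1,2)] d2(2)[OF h(1,3)]] this[of ?a ?b] show False
    unfolding eq by (metis field_sum_of_halves not_le)
qed

lemma frechet_derivative_bounded_linear:
  assumes "bounded_linear L" "f differentiable (at x)"
  shows "frechet_derivative (\<lambda>x. L (f x)) (at x) v = L (frechet_derivative f (at x) v)"
  using frechet_derivative_at[OF bounded_linear.has_derivative[OF assms(1),
    OF assms(2)[unfolded frechet_derivative_works]]] by metis

lemma smooth_on_bounded_linear:
  "open S \<Longrightarrow> bounded_linear L \<Longrightarrow> smooth_on S f \<Longrightarrow> smooth_on S (\<lambda>x. L (f x))"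
  by (simp add: smooth_on_def Ck_bounded_linear)

lemma smooth_on_cong:
  "open S \<Longrightarrow> (\<And>x. x \<in> S \<Longrightarrow> f x = g x) \<Longrightarrow> smooth_on S f \<Longrightarrow> smooth_on S g"
  unfolding smooth_on_def using Ck_cong by blast

lemma smooth_on_imp_differentiable: "smooth_on S f \<Longrightarrow> x \<in> S \<Longrightarrow> f differentiable (at x)"
  using smooth_on_imp_has_derivative differentiable_def by blast

text \<open>The mean value theorem works for real values, so the complex case is read off from real
  and imaginary parts.\<close>

lemma symmetric_second_derivative:
  fixes f :: "'v::euclidean_space \<Rightarrow> complex"
  assumes "open S" "smooth_on S f" "y \<in> S"
  shows "frechet_derivative (\<lambda>x. frechet_derivative f (at x) v) (at y) w =
         frechet_derivative (\<lambda>x. frechet_derivative f (at x) w) (at y) v"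
proof -
  have *: "L (frechet_derivative (\<lambda>x. frechet_derivative f (at x) v) (at y) w) =
    frechet_derivative (\<lambda>x. frechet_derivative (\<lambda>x. L (f x)) (at x) v) (at y) w"
    if L: "bounded_linear L" for L :: "complex \<Rightarrow> real" and v w
  proof -
    note s = smooth_on_frechet_derivative[OF assms(2), of v]
    have "L (frechet_derivative (\<lambda>x. frechet_derivative f (at x) v) (at y) w) =
        frechet_derivative (\<lambda>x. L (frechet_derivative f (at x) v)) (at y) w"
      using frechet_derivative_bounded_linear[OF L smooth_on_imp_differentiable[OF s assms(3)]] by simp
    also have "frechet_derivative (\<lambda>x. L (frechet_derivative f (at x) v)) (at y) =
        frechet_derivative (\<lambda>x. frechet_derivative (\<lambda>x. L (f x)) (at x) v) (at y)"
      using smooth_on_bounded_linear[OF assms(1) L s] assms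
      by (intro frechet_derivative_transform_within_open[OF _ assms(1,3)])
        (auto simp: frechet_derivative_bounded_linear[OF L smooth_on_imp_differentiable]
          intro: smooth_on_imp_differentiable)
    finally show ?thesis .
  qed
  have L: "L (frechet_derivative (\<lambda>x. frechet_derivative f (at x) v) (at y) w) =
         L (frechet_derivative (\<lambda>x. frechet_derivative f (at x) w) (at y) v)"
    if "bounded_linear L" for L :: "complex \<Rightarrow> real"
    using symmetric_second_derivative_real[OF assms(1) smooth_on_bounded_linear[OF assms(1) that assms(2)] assms(3)]
    by (simp add: *[OF that])
  show ?thesis
    using L[OF bounded_linear_Re] L[OF bounded_linear_Im] by (simp add: complex_eq_iff)
qed

lemma smooth_on_subset: "T \<subseteq> S \<Longrightarrow> smooth_on S f \<Longrightarrow> smooth_on T f"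
  unfolding smooth_on_def using Ck_subset by blast

lemma smooth_on_const: "open S \<Longrightarrow> smooth_on S (\<lambda>x. c)"
  by (simp add: smooth_on_def Ck_const)

lemma smooth_on_add:
  "open S \<Longrightarrow> smooth_on S f \<Longrightarrow> smooth_on S g \<Longrightarrow> smooth_on S (\<lambda>x. f x + g x)"
  by (simp add: smooth_on_def Ck_add)

lemma smooth_on_mult:
  fixes f g :: "'v::euclidean_space \<Rightarrow> 'w::real_normed_algebra"
  shows "open S \<Longrightarrow> smooth_on S f \<Longrightarrow> smooth_on S g \<Longrightarrow> smooth_on S (\<lambda>x. f x * g x)"
  by (simp add: smooth_on_def Ck_mult)

lemma smooth_on_inverse:
  fixes f :: "'v::euclidean_space \<Rightarrow> 'w::real_normed_div_algebra"
  shows "open S \<Longrightarrow> (\<And>x. x \<in> S \<Longrightarrow> f x \<noteq> 0) \<Longrightarrow> smooth_on S f \<Longrightarrow> smooth_on S (\<lambda>x. inverse (f x))"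
  by (simp add: smooth_on_def Ck_inverse)

lemma smooth_on_sqrt:
  fixes f :: "'v::euclidean_space \<Rightarrow> real"
  shows "open S \<Longrightarrow> (\<And>x. x \<in> S \<Longrightarrow> f x > 0) \<Longrightarrow> smooth_on S f \<Longrightarrow> smooth_on S (\<lambda>x. sqrt (f x))"
  by (simp add: smooth_on_def Ck_sqrt)

section \<open>Scalar fields in a chart\<close>

text \<open>Openness of \<open>N\<close> is recorded in coordinates, so the calculus below happens
  entirely in Euclidean space.\<close>

locale chart_nbhd =
  fixes c :: "('a, 'n::finite) chart" and N :: "'a set"
  assumes inj: "inj_on (chart_map c) (chart_dom c)"
    and sub: "N \<subseteq> chart_dom c"
    and opn: "open (chart_map c ` N)"
begin

definition smooth :: "('a \<Rightarrow> 'w::real_normed_vector) \<Rightarrow> bool" where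
  "smooth u \<longleftrightarrow> smooth_on (chart_map c ` N) (u \<circ> chart_inv c)"

lemma chart_inv_map [simp]: "x \<in> N \<Longrightarrow> chart_inv c (chart_map c x) = x"
  using inj sub by (simp add: chart_inv_def inv_into_f_f subset_iff)

lemma smooth_cong: "(\<And>x. x \<in> N \<Longrightarrow> u x = v x) \<Longrightarrow> smooth u \<Longrightarrow> smooth v"
  unfolding smooth_def by (rule smooth_on_cong[OF opn]) auto

lemma smooth_differentiable:
  "smooth u \<Longrightarrow> x \<in> N \<Longrightarrow> (u \<circ> chart_inv c) differentiable (at (chart_map c x))"
  unfolding smooth_def by (auto intro: smooth_on_imp_differentiable)

lemma smooth_has_derivative:
  "smooth u \<Longrightarrow> x \<in> N \<Longrightarrow>
    ((\<lambda>y. u (chart_inv c y)) has_derivative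
      frechet_derivative (u \<circ> chart_inv c) (at (chart_map c x))) (at (chart_map c x))"
  using smooth_differentiable[of u x] by (simp add: frechet_derivative_works o_def)

text \<open>A derivative sees only the germ, so an identity known merely on \<open>N\<close> may be
  differentiated there. The frame identities below are all of this kind.\<close>

lemma pd_cong:
  assumes "\<And>x. x \<in> N \<Longrightarrow> u x = v x" "smooth v" "x \<in> N"
  shows "pd c j u x = pd c j v x"
proof -
  have "frechet_derivative (v \<circ> chart_inv c) (at (chart_map c x)) =
      frechet_derivative (u \<circ> chart_inv c) (at (chart_map c x))"
    using assms by (intro frechet_derivative_transform_within_open[OF smooth_differentiable opn]) auto
  then show ?thesis by (simp add: pd_def)
qed

lemma pdI:
  "((\<lambda>y. u (chart_inv c y)) has_derivative D) (at (chart_map c x)) \<Longrightarrow> pd c j u x = D (axis j 1)"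
  unfolding pd_def o_def by (metis frechet_derivative_at)

lemma smooth_const [simp, intro]: "smooth (\<lambda>x. a)"
  unfolding smooth_def o_def by (rule smooth_on_const[OF opn])

lemma smooth_bounded_linear: "bounded_linear L \<Longrightarrow> smooth u \<Longrightarrow> smooth (\<lambda>x. L (u x))"
  unfolding smooth_def o_def by (rule smooth_on_bounded_linear[OF opn])

lemma smooth_add [intro]: "smooth u \<Longrightarrow> smooth v \<Longrightarrow> smooth (\<lambda>x. u x + v x)"
  unfolding smooth_def o_def by (rule smooth_on_add[OF opn])

lemma smooth_minus [intro]: "smooth u \<Longrightarrow> smooth (\<lambda>x. - u x)"
  by (rule smooth_bounded_linear[OF bounded_linear_minus[OF bounded_linear_ident]])

lemma smooth_diff [intro]: "smooth u \<Longrightarrow> smooth v \<Longrightarrow> smooth (\<lambda>x. u x - v x)"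
  using smooth_add[OF _ smooth_minus, of u v] by simp

lemma smooth_mult [intro]:
  fixes u v :: "'a \<Rightarrow> 'w::real_normed_algebra"
  shows "smooth u \<Longrightarrow> smooth v \<Longrightarrow> smooth (\<lambda>x. u x * v x)"
  unfolding smooth_def o_def by (rule smooth_on_mult[OF opn])

lemma smooth_inverse:
  fixes u :: "'a \<Rightarrow> 'w::real_normed_div_algebra"
  shows "(\<And>x. x \<in> N \<Longrightarrow> u x \<noteq> 0) \<Longrightarrow> smooth u \<Longrightarrow> smooth (\<lambda>x. inverse (u x))"
  unfolding smooth_def o_def by (rule smooth_on_inverse[OF opn]) auto

lemma smooth_sqrt:
  fixes u :: "'a \<Rightarrow> real"
  shows "(\<And>x. x \<in> N \<Longrightarrow> u x > 0) \<Longrightarrow> smooth u \<Longrightarrow> smooth (\<lambda>x. sqrt (u x))"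
  unfolding smooth_def o_def by (rule smooth_on_sqrt[OF opn]) auto

lemma smooth_sum [intro]: "(\<And>i. i \<in> I \<Longrightarrow> smooth (u i)) \<Longrightarrow> smooth (\<lambda>x. \<Sum>i\<in>I. u i x)"
  by (induction I rule: infinite_finite_induct) auto

lemma smooth_prod [intro]:
  fixes u :: "'i \<Rightarrow> 'a \<Rightarrow> complex"
  shows "(\<And>i. i \<in> I \<Longrightarrow> smooth (u i)) \<Longrightarrow> smooth (\<lambda>x. \<Prod>i\<in>I. u i x)"
  by (induction I rule: infinite_finite_induct) auto

lemma smooth_of_real: "smooth u \<Longrightarrow> smooth (\<lambda>x. complex_of_real (u x))"
  by (rule smooth_bounded_linear[OF bounded_linear_of_real])

lemma smooth_of_realD: "smooth (\<lambda>x. complex_of_real (u x)) \<Longrightarrow> smooth u"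
  using smooth_bounded_linear[OF bounded_linear_Re, of "\<lambda>x. complex_of_real (u x)"] by simp

lemma pd_const [simp]: "pd c j (\<lambda>x. a) x = 0"
  by (simp add: pd_def o_def)

lemma pd_bounded_linear:
  "bounded_linear L \<Longrightarrow> smooth u \<Longrightarrow> x \<in> N \<Longrightarrow> pd c j (\<lambda>x. L (u x)) x = L (pd c j u x)"
  unfolding pd_def[of c j u]
  by (rule pdI[OF bounded_linear.has_derivative[OF _ smooth_has_derivative]])

lemma pd_of_real:
  "smooth u \<Longrightarrow> x \<in> N \<Longrightarrow> pd c j (\<lambda>x. complex_of_real (u x)) x = of_real (pd c j u x)"
  by (rule pd_bounded_linear[OF bounded_linear_of_real])

lemma pd_add:
  "smooth u \<Longrightarrow> smooth v \<Longrightarrow> x \<in> N \<Longrightarrow> pd c j (\<lambda>x. u x + v x) x = pd c j u x + pd c j v x"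
  unfolding pd_def[of c j u] pd_def[of c j v]
  by (rule pdI[OF has_derivative_add[OF smooth_has_derivative smooth_has_derivative]])

lemma pd_diff:
  "smooth u \<Longrightarrow> smooth v \<Longrightarrow> x \<in> N \<Longrightarrow> pd c j (\<lambda>x. u x - v x) x = pd c j u x - pd c j v x"
  unfolding pd_def[of c j u] pd_def[of c j v]
  by (rule pdI[OF has_derivative_diff[OF smooth_has_derivative smooth_has_derivative]])

lemma pd_mult:
  fixes u v :: "'a \<Rightarrow> 'w::real_normed_algebra"
  assumes "smooth u" "smooth v" "x \<in> N"
  shows "pd c j (\<lambda>x. u x * v x) x = pd c j u x * v x + u x * pd c j v x"
proof -
  note D = smooth_has_derivative[OF assms(1,3)] smooth_has_derivative[OF assms(2,3)]
  show ?thesis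
    using pdI[OF has_derivative_mult[OF D], of j] assms(3)
    by (simp add: pd_def[of c j u] pd_def[of c j v] add.commute)
qed

lemma pd_sum:
  "(\<And>i. i \<in> I \<Longrightarrow> smooth (u i)) \<Longrightarrow> x \<in> N \<Longrightarrow>
    pd c j (\<lambda>x. \<Sum>i\<in>I. u i x) x = (\<Sum>i\<in>I. pd c j (u i) x)"
  by (induction I rule: infinite_finite_induct) (auto simp: pd_add smooth_sum)

lemma smooth_pd [intro]:
  assumes "smooth u"
  shows "smooth (pd c j u)"
  unfolding smooth_def
  by (rule smooth_on_cong[OF opn _ smooth_on_frechet_derivative[OF assms[unfolded smooth_def]]])
    (auto simp: pd_def)

lemma pd_commute:
  fixes u :: "'a \<Rightarrow> complex"
  assumes "smooth u" "x \<in> N"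
  shows "pd c i (pd c j u) x = pd c j (pd c i u) x"
proof -
  have *: "pd c i (pd c j u) x =
      frechet_derivative (\<lambda>y. frechet_derivative (u \<circ> chart_inv c) (at y) (axis j 1))
        (at (chart_map c x)) (axis i 1)" for i j
  proof -
    have "frechet_derivative (pd c j u \<circ> chart_inv c) (at (chart_map c x)) =
      frechet_derivative (\<lambda>y. frechet_derivative (u \<circ> chart_inv c) (at y) (axis j 1)) (at (chart_map c x))"
      using assms(2)
      by (intro frechet_derivative_transform_within_open[OF smooth_differentiable[OF smooth_pd] opn])
        (auto simp: assms(1) pd_def)
    then show ?thesis by (simp add: pd_def[of c i "pd c j u"])
  qed
  show ?thesis
    unfolding * using assms by (intro symmetric_second_derivative[OF opn]) (auto simp: smooth_def)
qed

end

section \<open>Null frames\<close>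

primrec sval :: "sign \<Rightarrow> int" where
  "sval Plus = 1"
| "sval Minus = -1"

primrec opp :: "sign \<Rightarrow> sign" where
  "opp Plus = Minus"
| "opp Minus = Plus"

definition weight :: "sign list \<Rightarrow> int" where
  "weight is = (\<Sum>s\<leftarrow>is. sval s)"

lemma weight_simps [simp]: "weight [] = 0" "weight (s # is) = sval s + weight is"
  by (simp_all add: weight_def)

lemma symmetric_nth: "transpose B = B \<Longrightarrow> B $ i $ j = B $ j $ i"
  by (simp add: transpose_def vec_eq_iff)

section \<open>Linear algebra of null pairs in dimension two\<close>

text \<open>The form is extended complex-bilinearly, without conjugation; 2 is its value on
  \<open>e 1 - i e 2\<close> and \<open>e 1 + i e 2\<close> for an orthonormal basis.\<close>

definition null_pair :: "real ^ 2 ^ 2 \<Rightarrow> (sign \<Rightarrow> 2 \<Rightarrow> complex) \<Rightarrow> bool" where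
  "null_pair B k \<longleftrightarrow> (\<forall>s s'. (\<Sum>i\<in>UNIV. \<Sum>j\<in>UNIV. of_real (B $ i $ j) * k s i * k s' j) =
      (if s = s' then 0 else 2))"

lemma null_pair_explicit:
  assumes "transpose B = B" "null_pair B k"
  shows "of_real (B $ 1 $ 1) * k s 1 * k s 1 + 2 * of_real (B $ 1 $ 2) * k s 1 * k s 2 +
      of_real (B $ 2 $ 2) * k s 2 * k s 2 = (0::complex)"
    and "of_real (B $ 1 $ 1) * k Plus 1 * k Minus 1 +
      of_real (B $ 1 $ 2) * (k Plus 1 * k Minus 2 + k Plus 2 * k Minus 1) +
      of_real (B $ 2 $ 2) * k Plus 2 * k Minus 2 = (2::complex)"
proof -
  have B: "B $ 2 $ 1 = B $ 1 $ 2"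
    using symmetric_nth[OF assms(1)] .
  show "of_real (B $ 1 $ 1) * k s 1 * k s 1 + 2 * of_real (B $ 1 $ 2) * k s 1 * k s 2 +
      of_real (B $ 2 $ 2) * k s 2 * k s 2 = (0::complex)"
    using assms(2)[unfolded null_pair_def, rule_format, of s s] by (simp add: sum_2 B algebra_simps)
  show "of_real (B $ 1 $ 1) * k Plus 1 * k Minus 1 +
      of_real (B $ 1 $ 2) * (k Plus 1 * k Minus 2 + k Plus 2 * k Minus 1) +
      of_real (B $ 2 $ 2) * k Plus 2 * k Minus 2 = (2::complex)"
    using assms(2)[unfolded null_pair_def, rule_format, of Plus Minus] by (simp add: sum_2 B algebra_simps)
qed

text \<open>Gram determinant: the pairings form the matrix with rows (0, 2) and (2, 0), of
  determinant -4. In particular the two null vectors are independent and \<open>B\<close> is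
  invertible.\<close>

lemma null_pair_det:
  assumes "transpose B = B" "null_pair B k"
  shows "of_real (det B) * (k Plus 1 * k Minus 2 - k Plus 2 * k Minus 1)\<^sup>2 = (-4::complex)"
proof -
  have B: "B $ 2 $ 1 = B $ 1 $ 2"
    using symmetric_nth[OF assms(1)] .
  note e = null_pair_explicit[OF assms]
  define a b d where "a = complex_of_real (B $ 1 $ 1)" and "b = complex_of_real (B $ 1 $ 2)"
    and "d = complex_of_real (B $ 2 $ 2)"
  define p q m n where "p = k Plus 1" and "q = k Plus 2" and "m = k Minus 1" and "n = k Minus 2"
  note defs = a_def[symmetric] b_def[symmetric] d_def[symmetric]
    p_def[symmetric] q_def[symmetric] m_def[symmetric] n_def[symmetric]
  have 1: "a * p * p + 2 * b * p * q + d * q * q = 0"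
    and 2: "a * m * m + 2 * b * m * n + d * n * n = 0"
    and 3: "a * p * m + b * (p * n + q * m) + d * q * n = 2"
    using e(1)[of Plus] e(1)[of Minus] e(2) by (simp_all add: defs)
  have "(a * d - b * b) * (p * n - q * m)\<^sup>2 =
     (a * p * p + 2 * b * p * q + d * q * q) * (a * m * m + 2 * b * m * n + d * n * n) -
     (a * p * m + b * (p * n + q * m) + d * q * n)\<^sup>2"
    by (simp add: algebra_simps power2_eq_square)
  then have "(a * d - b * b) * (p * n - q * m)\<^sup>2 = -4" unfolding 1 2 3 by simp
  then show ?thesis by (simp add: det_2 B defs)
qed

text \<open>In a null frame the coefficient along one vector is half the pairing with the other one.
  It suffices that the map sending \<open>v\<close> to the bracketed combination, minus
  \<open>2 v\<close>, has zero matrix.\<close>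

lemma null_pair_expansion:
  assumes "transpose B = B" "null_pair B k"
  shows "v i = ((\<Sum>a\<in>UNIV. \<Sum>b\<in>UNIV. of_real (B $ a $ b) * v a * k Minus b) * k Plus i +
    (\<Sum>a\<in>UNIV. \<Sum>b\<in>UNIV. of_real (B $ a $ b) * v a * k Plus b) * k Minus i) / (2::complex)"
proof -
  have B: "B $ 2 $ 1 = B $ 1 $ 2"
    using symmetric_nth[OF assms(1)] .
  note e = null_pair_explicit[OF assms]
  define a b d where "a = complex_of_real (B $ 1 $ 1)" and "b = complex_of_real (B $ 1 $ 2)"
    and "d = complex_of_real (B $ 2 $ 2)"
  define p q m n where "p = k Plus 1" and "q = k Plus 2" and "m = k Minus 1" and "n = k Minus 2"
  note defs = a_def[symmetric] b_def[symmetric] d_def[symmetric]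
    p_def[symmetric] q_def[symmetric] m_def[symmetric] n_def[symmetric]
  have 1: "a * p * p + 2 * b * p * q + d * q * q = 0"
    and 2: "a * m * m + 2 * b * m * n + d * n * n = 0"
    and 3: "a * p * m + b * (p * n + q * m) + d * q * n = 2"
    using e(1)[of Plus] e(1)[of Minus] e(2) by (simp_all add: defs)
  have e0: "p * n - q * m \<noteq> 0"
    using null_pair_det[OF assms] by (auto simp: defs)
  \<comment> \<open>A covector vanishing on both null vectors is zero, because they are
    independent.\<close>
  have cramer: "X = 0 \<and> Y = 0" if "X * p + Y * q = 0" "X * m + Y * n = 0" for X Y
  proof -
    have "X * (p * n - q * m) = (X * p + Y * q) * n - (X * m + Y * n) * q"
      and "Y * (p * n - q * m) = (X * m + Y * n) * p - (X * p + Y * q) * m"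
      by (simp_all add: algebra_simps)
    then show ?thesis using that e0 by simp
  qed
  \<comment> \<open>First row of that matrix, tested on both null vectors; the second row follows in
    \<open>**\<close>.\<close>
  have *: "(a * m + b * n) * p + (a * p + b * q) * m - 2 = 0 \<and> (b * m + d * n) * p + (b * p + d * q) * m = 0"
  proof (rule cramer)
    have "((a * m + b * n) * p + (a * p + b * q) * m - 2) * p +
        ((b * m + d * n) * p + (b * p + d * q) * m) * q =
      (a * p * m + b * (p * n + q * m) + d * q * n - 2) * p + (a * p * p + 2 * b * p * q + d * q * q) * m"
      by (simp add: algebra_simps)
    then show "((a * m + b * n) * p + (a * p + b * q) * m - 2) * p +
        ((b * m + d * n) * p + (b * p + d * q) * m) * q = 0" unfolding 1 3 by simp
    have "((a * m + b * n) * p + (a * p + b * q) * m - 2) * m +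
        ((b * m + d * n) * p + (b * p + d * q) * m) * n =
      (a * p * m + b * (p * n + q * m) + d * q * n - 2) * m + (a * m * m + 2 * b * m * n + d * n * n) * p"
      by (simp add: algebra_simps)
    then show "((a * m + b * n) * p + (a * p + b * q) * m - 2) * m +
        ((b * m + d * n) * p + (b * p + d * q) * m) * n = 0" unfolding 2 3 by simp
  qed
  have **: "(a * m + b * n) * q + (a * p + b * q) * n = 0 \<and> (b * m + d * n) * q + (b * p + d * q) * n - 2 = 0"
  proof (rule cramer)
    have "((a * m + b * n) * q + (a * p + b * q) * n) * p +
        ((b * m + d * n) * q + (b * p + d * q) * n - 2) * q =
      (a * p * m + b * (p * n + q * m) + d * q * n - 2) * q + (a * p * p + 2 * b * p * q + d * q * q) * n"
      by (simp add: algebra_simps)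
    then show "((a * m + b * n) * q + (a * p + b * q) * n) * p +
        ((b * m + d * n) * q + (b * p + d * q) * n - 2) * q = 0" unfolding 1 3 by simp
    have "((a * m + b * n) * q + (a * p + b * q) * n) * m +
        ((b * m + d * n) * q + (b * p + d * q) * n - 2) * n =
      (a * p * m + b * (p * n + q * m) + d * q * n - 2) * n + (a * m * m + 2 * b * m * n + d * n * n) * q"
      by (simp add: algebra_simps)
    then show "((a * m + b * n) * q + (a * p + b * q) * n) * m +
        ((b * m + d * n) * q + (b * p + d * q) * n - 2) * n = 0" unfolding 2 3 by simp
  qed
  have 4: "2 * v1 = (a * v1 * m + b * (v1 * n + v2 * m) + d * v2 * n) * p +
      (a * v1 * p + b * (v1 * q + v2 * p) + d * v2 * q) * m" for v1 v2
  proof -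
    have "(a * v1 * m + b * (v1 * n + v2 * m) + d * v2 * n) * p +
      (a * v1 * p + b * (v1 * q + v2 * p) + d * v2 * q) * m - 2 * v1 =
      ((a * m + b * n) * p + (a * p + b * q) * m - 2) * v1 + ((b * m + d * n) * p + (b * p + d * q) * m) * v2"
      by (simp add: algebra_simps)
    then show ?thesis using * by simp
  qed
  have 5: "2 * v2 = (a * v1 * m + b * (v1 * n + v2 * m) + d * v2 * n) * q +
      (a * v1 * p + b * (v1 * q + v2 * p) + d * v2 * q) * n" for v1 v2
  proof -
    have "(a * v1 * m + b * (v1 * n + v2 * m) + d * v2 * n) * q +
      (a * v1 * p + b * (v1 * q + v2 * p) + d * v2 * q) * n - 2 * v2 =
      ((a * m + b * n) * q + (a * p + b * q) * n) * v1 + ((b * m + d * n) * q + (b * p + d * q) * n - 2) * v2"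
      by (simp add: algebra_simps)
    then show ?thesis using ** by simp
  qed
  have "i = 1 \<or> i = 2" using exhaust_2 by blast
  then have "v i * 2 = (a * v 1 * m + b * (v 1 * n + v 2 * m) + d * v 2 * n) * k Plus i +
      (a * v 1 * p + b * (v 1 * q + v 2 * p) + d * v 2 * q) * k Minus i"
  proof
    assume "i = 1"
    then show ?thesis using 4[of "v 1" "v 2"] by (simp only: defs mult.commute[of _ 2])
  next
    assume "i = 2"
    then show ?thesis using 5[of "v 2" "v 1"] by (simp only: defs mult.commute[of _ 2])
  qed
  moreover have "(\<Sum>a\<in>UNIV. \<Sum>b\<in>UNIV. of_real (B $ a $ b) * v a * k Minus b) =
      a * v 1 * m + b * (v 1 * n + v 2 * m) + d * v 2 * n"
    and "(\<Sum>a\<in>UNIV. \<Sum>b\<in>UNIV. of_real (B $ a $ b) * v a * k Plus b) =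
      a * v 1 * p + b * (v 1 * q + v 2 * p) + d * v 2 * q"
    by (simp_all add: sum_2 B defs algebra_simps)
  ultimately show ?thesis by simp
qed

text \<open>A column of the inverse matrix pairs with \<open>k s\<close> to the entry
  \<open>k s j\<close>; inserting these pairings into \<open>null_pair_expansion\<close> gives the
  inverse metric as a symmetric product.\<close>

lemma ginv_null_pair:
  assumes "transpose (g c x) = g c x" "null_pair (g c x) k"
  shows "of_real (ginv g c x i j) = (k Plus i * k Minus j + k Minus i * k Plus j) / 2"
    and "(\<Sum>l\<in>UNIV. g c x $ i $ l * ginv g c x l j) = (if i = j then 1 else 0)"
proof -
  define B where "B = g c x"
  have B: "transpose B = B" "null_pair B k" using assms by (auto simp: B_def)
  have "det B \<noteq> 0" using null_pair_det[OF B] by auto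
  then have inv: "invertible B" by (simp add: invertible_det_nz)
  then have "B ** matrix_inv B = mat 1"
    unfolding matrix_inv_def invertible_def by (auto intro: someI2_ex)
  then have r: "(\<Sum>l\<in>UNIV. B $ i $ l * matrix_inv B $ l $ j) = (if i = j then 1 else 0)" for i j
    by (auto simp: matrix_matrix_mult_def mat_def vec_eq_iff)
  show "(\<Sum>l\<in>UNIV. g c x $ i $ l * ginv g c x l j) = (if i = j then 1 else 0)"
    using r by (auto simp: ginv_def B_def)
  have rc: "(\<Sum>l\<in>UNIV. of_real (B $ i $ l) * complex_of_real (matrix_inv B $ l $ j)) = (if i = j then 1 else 0)" for i j
    using arg_cong[OF r[of i j], of complex_of_real] by (auto simp: sum_2)
  have sy: "B $ a $ b = B $ b $ a" for a b
    using symmetric_nth[OF B(1)] .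
  have ex: "complex_of_real (matrix_inv B $ i $ j) =
    ((\<Sum>a\<in>UNIV. \<Sum>b\<in>UNIV. of_real (B $ a $ b) * complex_of_real (matrix_inv B $ a $ j) * k Minus b) * k Plus i +
    (\<Sum>a\<in>UNIV. \<Sum>b\<in>UNIV. of_real (B $ a $ b) * complex_of_real (matrix_inv B $ a $ j) * k Plus b) * k Minus i) / 2"
    using null_pair_expansion[OF B, of "\<lambda>a. complex_of_real (matrix_inv B $ a $ j)" i] .
  have in': "(\<Sum>a\<in>UNIV. \<Sum>b\<in>UNIV. of_real (B $ a $ b) * complex_of_real (matrix_inv B $ a $ j) * k s b) = k s j" for s
  proof -
    have "(\<Sum>a\<in>UNIV. \<Sum>b\<in>UNIV. of_real (B $ a $ b) * complex_of_real (matrix_inv B $ a $ j) * k s b) =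
      (\<Sum>b\<in>UNIV. (\<Sum>a\<in>UNIV. of_real (B $ b $ a) * complex_of_real (matrix_inv B $ a $ j)) * k s b)"
      by (subst sum.swap) (simp add: sum_distrib_right sy[of _ "_::2"] cong: sum.cong)
    also have "\<dots> = k s j" unfolding rc by (simp add: sum.delta if_distrib[of "\<lambda>z. z * _"] cong: if_cong)
    finally show ?thesis .
  qed
  show "of_real (ginv g c x i j) = (k Plus i * k Minus j + k Minus i * k Plus j) / 2"
    using ex unfolding in' by (simp add: ginv_def B_def algebra_simps)
qed

text \<open>In two complex dimensions the null vectors fill just two lines. Hence
  \<open>k Plus\<close> lies on the line of \<open>h Plus\<close> or on that of
  \<open>h Minus\<close>, and the pairing 2 then fixes the scale of \<open>k Minus\<close>.\<close>

lemma null_pair_unique: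
  assumes "transpose B = B" "null_pair B h" "null_pair B k"
  obtains u where "u \<noteq> 0" "\<And>j. k Plus j = u * h Plus j" "\<And>j. k Minus j = inverse u * h Minus j"
  | u where "u \<noteq> 0" "\<And>j. k Plus j = u * h Minus j" "\<And>j. k Minus j = inverse u * h Plus j"
proof -
  note np = assms[unfolded null_pair_def]
  obtain \<alpha> \<beta> where k: "\<And>s j. k s j = \<alpha> s * h Plus j + \<beta> s * h Minus j"
  proof
    show "k s j = (\<lambda>s. (\<Sum>a\<in>UNIV. \<Sum>b\<in>UNIV. of_real (B $ a $ b) * k s a * h Minus b) / 2) s * h Plus j +
      (\<lambda>s. (\<Sum>a\<in>UNIV. \<Sum>b\<in>UNIV. of_real (B $ a $ b) * k s a * h Plus b) / 2) s * h Minus j" for s j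
      using null_pair_expansion[OF assms(1,2), of "k s" j] by (simp add: field_simps)
  qed
  \<comment> \<open>The null conditions in the coordinates \<alpha>, \<beta> relative to
    \<open>h\<close>.\<close>
  have pair: "2 * (\<alpha> s * \<beta> s' + \<beta> s * \<alpha> s') = (if s = s' then 0 else 2)" for s s'
  proof -
    have "(if s = s' then 0 else 2) =
      (\<Sum>i\<in>UNIV. \<Sum>j\<in>UNIV. complex_of_real (B $ i $ j) * k s i * k s' j)"
      using np(3) by simp
    also have "\<dots> = \<alpha> s * \<alpha> s' * (\<Sum>i\<in>UNIV. \<Sum>j\<in>UNIV. of_real (B $ i $ j) * h Plus i * h Plus j)
      + \<alpha> s * \<beta> s' * (\<Sum>i\<in>UNIV. \<Sum>j\<in>UNIV. of_real (B $ i $ j) * h Plus i * h Minus j)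
      + \<beta> s * \<alpha> s' * (\<Sum>i\<in>UNIV. \<Sum>j\<in>UNIV. of_real (B $ i $ j) * h Minus i * h Plus j)
      + \<beta> s * \<beta> s' * (\<Sum>i\<in>UNIV. \<Sum>j\<in>UNIV. of_real (B $ i $ j) * h Minus i * h Minus j)"
      unfolding k by (simp add: sum_2 algebra_simps)
    also have "\<dots> = 2 * (\<alpha> s * \<beta> s' + \<beta> s * \<alpha> s')"
      using np(2) by simp
    finally show ?thesis by simp
  qed
  have p: "\<alpha> Plus * \<beta> Plus = 0" "\<alpha> Minus * \<beta> Minus = 0"
    "\<alpha> Plus * \<beta> Minus + \<beta> Plus * \<alpha> Minus = 1"
    using pair[of Plus Plus] pair[of Minus Minus] pair[of Plus Minus] by (auto simp: algebra_simps)
  show thesis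
  proof (cases "\<beta> Plus = 0")
    case True
    then have m: "\<alpha> Plus * \<beta> Minus = 1" using p by simp
    then have "\<alpha> Plus \<noteq> 0" "\<alpha> Minus = 0" "\<beta> Minus = inverse (\<alpha> Plus)"
      using p by (auto simp: inverse_unique)
    then show thesis using that(1)[of "\<alpha> Plus"] True by (simp add: k)
  next
    case False
    then have a: "\<alpha> Plus = 0" using p by simp
    then have m: "\<beta> Plus * \<alpha> Minus = 1" using p by simp
    then have "\<beta> Minus = 0" "\<alpha> Minus = inverse (\<beta> Plus)"
      using p by (auto simp: inverse_unique)
    then show thesis using that(2)[of "\<beta> Plus"] a False by (simp add: k)
  qed
qed

lemma weight_replicate [simp]: "weight (replicate k s) = int k * sval s"
  by (induction k) (auto simp: algebra_simps)

lemma sval_sq: "sval s * sval s = 1"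
  by (cases s) auto

section \<open>Metric and Levi-Civita connection in the presence of a null frame\<close>

text \<open>Curvature enters through the single component \<open>g(R(d1, d2) d2, d1)\<close>, where
  \<open>d1\<close>, \<open>d2\<close> are the coordinate fields; in dimension two this is all the
  information there is.\<close>

locale null_frame = chart_nbhd c N for c :: "('a, 2) chart" and N :: "'a set" +
  fixes g :: "('a, 2) metric" and h :: "sign \<Rightarrow> 2 \<Rightarrow> 'a \<Rightarrow> complex" and K :: real
  assumes metric_symmetric: "x \<in> N \<Longrightarrow> transpose (g c x) = g c x"
    and smooth_metric: "smooth (\<lambda>x. g c x $ i $ j)"
    and smooth_h [intro]: "smooth (h s i)"
    and null: "x \<in> N \<Longrightarrow> null_pair (g c x) (\<lambda>s j. h s j x)"
    and curvature: "x \<in> N \<Longrightarrow> (\<Sum>l\<in>UNIV. g c x $ l $ 1 * riemann g c x l 1 2 2) = K * det (g c x)"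
begin

abbreviation d :: "2 \<Rightarrow> ('a \<Rightarrow> complex) \<Rightarrow> 'a \<Rightarrow> complex" where
  "d \<equiv> pd c"

text \<open>The real coefficients are made complex once, so that the product rule applies to their
  products with frame components.\<close>

definition G :: "2 \<Rightarrow> 2 \<Rightarrow> 'a \<Rightarrow> complex" where
  "G i j x = of_real (g c x $ i $ j)"

definition H :: "2 \<Rightarrow> 2 \<Rightarrow> 'a \<Rightarrow> complex" where
  "H i j x = of_real (ginv g c x i j)"

definition Gam :: "2 \<Rightarrow> 2 \<Rightarrow> 2 \<Rightarrow> 'a \<Rightarrow> complex" where
  "Gam l i j x = of_real (christoffel g c x l i j)"

lemma smooth_G [intro]: "smooth (G i j)"
  unfolding G_def[abs_def] by (rule smooth_of_real[OF smooth_metric])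

lemma G_sym: "x \<in> N \<Longrightarrow> G i j x = G j i x"
  unfolding G_def using symmetric_nth[OF metric_symmetric] by metis

lemma pd_G_sym: "x \<in> N \<Longrightarrow> d k (G i j) x = d k (G j i) x"
  by (rule pd_cong[OF G_sym]) auto

lemma H_eq: "x \<in> N \<Longrightarrow> H i j x = (h Plus i x * h Minus j x + h Minus i x * h Plus j x) / 2"
  unfolding H_def by (rule ginv_null_pair(1)[where g = g and c = c, OF metric_symmetric null])

lemma G_H:
  assumes "x \<in> N"
  shows "(\<Sum>m\<in>UNIV. G i m x * H m j x) = (if i = j then 1 else 0)"
proof -
  have "(\<Sum>m\<in>UNIV. G i m x * H m j x) = of_real (\<Sum>m\<in>UNIV. g c x $ i $ m * ginv g c x m j)"
    by (simp add: G_def H_def)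
  then show ?thesis
    using ginv_null_pair(2)[where g = g and c = c, OF metric_symmetric[OF assms] null[OF assms]] by simp
qed

text \<open>The frame formula exhibits the inverse metric as a polynomial in smooth
  functions.\<close>

lemma smooth_H [intro]: "smooth (H i j)"
proof (rule smooth_cong)
  show "smooth (\<lambda>x. (h Plus i x * h Minus j x + h Minus i x * h Plus j x) * (1/2))"
    by (intro smooth_mult smooth_add smooth_h smooth_const)
qed (simp add: H_eq)

lemma Gam_eq:
  assumes "x \<in> N"
  shows "Gam k i j x = (1/2) * (\<Sum>l\<in>UNIV. H k l x * (d i (G j l) x + d j (G i l) x - d l (G i j) x))"
proof -
  have "d k (G i j) x = of_real (pd c k (\<lambda>y. g c y $ i $ j) x)" for i j k
    unfolding G_def[abs_def] by (rule pd_of_real[OF smooth_metric assms])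
  then show ?thesis by (simp add: Gam_def christoffel_def H_def)
qed

lemma smooth_Gam [intro]: "smooth (Gam k i j)"
proof (rule smooth_cong)
  show "smooth (\<lambda>x. (1/2) * (\<Sum>l\<in>UNIV. H k l x * (d i (G j l) x + d j (G i l) x - d l (G i j) x)))"
    by (intro smooth_mult smooth_sum smooth_add smooth_diff smooth_H smooth_pd smooth_G smooth_const)
qed (simp add: Gam_eq)

lemma Gam_sym: "x \<in> N \<Longrightarrow> Gam l i j x = Gam l j i x"
  by (simp add: Gam_eq pd_G_sym[of x _ i j] add.commute)

lemma lower_Gam:
  assumes "x \<in> N"
  shows "(\<Sum>m\<in>UNIV. G l m x * Gam m i j x) = (d i (G j l) x + d j (G i l) x - d l (G i j) x) / 2"
proof -
  define E where "E l = (d i (G j l) x + d j (G i l) x - d l (G i j) x) / 2" for l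
  have "(\<Sum>m\<in>UNIV. G l m x * Gam m i j x) = (\<Sum>m\<in>UNIV. G l m x * (\<Sum>k\<in>UNIV. H m k x * E k))"
    by (simp add: Gam_eq[OF assms] E_def sum_divide_distrib)
  also have "\<dots> = (\<Sum>k\<in>UNIV. (\<Sum>m\<in>UNIV. G l m x * H m k x) * E k)"
    by (simp add: sum_2 algebra_simps)
  also have "\<dots> = E l"
    unfolding G_H[OF assms] by (simp add: if_distrib[of "\<lambda>z. z * _"] cong: if_cong)
  finally show ?thesis by (simp add: E_def)
qed

text \<open>Each lowered Christoffel symbol is half a sum of three metric derivatives; when the two
  are added, symmetry of \<open>G\<close> cancels four of the six.\<close>

lemma metric_compatible:
  assumes "x \<in> N"
  shows "d k (G i j) x = (\<Sum>m\<in>UNIV. G j m x * Gam m k i x) + (\<Sum>m\<in>UNIV. G i m x * Gam m k j x)"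
  using pd_G_sym[OF assms, of k i j] pd_G_sym[OF assms, of i k j] pd_G_sym[OF assms, of j k i]
  by (simp add: lower_Gam[OF assms] field_simps)

section \<open>Connection form and curvature of the frame\<close>

text \<open>Component \<open>l\<close> of the covariant derivative of the vector field
  \<open>h s\<close> along coordinate direction \<open>j\<close>; \<open>nabh\<close> is its inner
  product with \<open>h s'\<close>.\<close>

definition nab :: "2 \<Rightarrow> sign \<Rightarrow> 2 \<Rightarrow> 'a \<Rightarrow> complex" where
  "nab j s l x = d j (h s l) x + (\<Sum>k\<in>UNIV. Gam l j k x * h s k x)"

definition nabh :: "2 \<Rightarrow> sign \<Rightarrow> sign \<Rightarrow> 'a \<Rightarrow> complex" where
  "nabh j s s' x = (\<Sum>a\<in>UNIV. \<Sum>b\<in>UNIV. G a b x * nab j s a x * h s' b x)"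

text \<open>The connection form \<Omega>; the half undoes the normalisation
  \<open>g(h Plus, h Minus) = 2\<close>.\<close>

definition Om :: "2 \<Rightarrow> 'a \<Rightarrow> complex" where
  "Om j x = nabh j Plus Minus x / 2"

lemma smooth_Om [intro]: "smooth (Om j)"
proof -
  have "smooth (\<lambda>x. (\<Sum>a\<in>UNIV. \<Sum>b\<in>UNIV. G a b x *
      (d j (h Plus a) x + (\<Sum>k\<in>UNIV. Gam a j k x * h Plus k x)) * h Minus b x) * (1/2))"
    by (intro smooth_mult smooth_sum smooth_add smooth_G smooth_pd smooth_Gam smooth_h smooth_const)
  then show ?thesis by (simp add: Om_def[abs_def] nabh_def nab_def)
qed

text \<open>The pairings of frame vectors are constant on \<open>N\<close>; differentiate them with
  metric compatibility.\<close>

lemma nabh_antisym: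
  assumes "x \<in> N"
  shows "nabh j s s' x + nabh j s' s x = 0"
proof -
  have "0 = d j (\<lambda>x. \<Sum>a\<in>UNIV. \<Sum>b\<in>UNIV. G a b x * h s a x * h s' b x) x"
    using pd_cong[of "\<lambda>x. \<Sum>a\<in>UNIV. \<Sum>b\<in>UNIV. G a b x * h s a x * h s' b x"
        "\<lambda>x. if s = s' then 0 else 2" x j] null assms
    by (simp add: null_pair_def G_def)
  also have "\<dots> = (\<Sum>a\<in>UNIV. \<Sum>b\<in>UNIV. (d j (G a b) x * h s a x + G a b x * d j (h s a) x) * h s' b x
      + G a b x * h s a x * d j (h s' b) x)"
    using assms by (simp add: pd_sum pd_mult smooth_sum smooth_mult smooth_G smooth_h)
  also have "\<dots> = nabh j s s' x + nabh j s' s x"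
    using G_sym[OF assms, of 2 1]
    by (simp add: metric_compatible[OF assms] nabh_def nab_def sum_2 algebra_simps)
  finally show ?thesis by simp
qed

text \<open>By antisymmetry the derivative of a null vector is orthogonal to that vector, hence
  proportional to it, and the two factors of proportionality are opposite.\<close>

lemma nab_eq:
  assumes "x \<in> N"
  shows "nab j s i x = of_int (sval s) * Om j x * h s i x"
proof -
  have *: "nab j s i x = (nabh j s Minus x * h Plus i x + nabh j s Plus x * h Minus i x) / 2" for s
    using null_pair_expansion[OF metric_symmetric[OF assms] null[OF assms], of "\<lambda>a. nab j s a x" i]
    by (simp add: nabh_def G_def)
  have 0: "nabh j s s x = 0" for s
    using nabh_antisym[OF assms, of j s s] by simp
  have 1: "nabh j Minus Plus x = - nabh j Plus Minus x"
    using nabh_antisym[OF assms, of j Minus Plus] by (simp add: eq_neg_iff_add_eq_0)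
  show ?thesis by (cases s) (simp_all add: * 0 1 Om_def)
qed

lemma pd_h:
  assumes "x \<in> N"
  shows "d j (h s l) x = of_int (sval s) * Om j x * h s l x - (\<Sum>k\<in>UNIV. Gam l j k x * h s k x)"
  using nab_eq[OF assms, of j s l] by (simp add: nab_def eq_diff_eq)

text \<open>The coefficient of the exterior derivative of \<Omega> on the coordinate area
  form.\<close>

definition rho :: "'a \<Rightarrow> complex" where
  "rho x = d 1 (Om 2) x - d 2 (Om 1) x"

lemma pd_pd_h:
  assumes "x \<in> N"
  shows "d i (d j (h s l)) x = of_int (sval s) * (d i (Om j) x * h s l x + Om j x * d i (h s l) x)
    - (\<Sum>k\<in>UNIV. d i (Gam l j k) x * h s k x + Gam l j k x * d i (h s k) x)"
proof -
  have "d i (d j (h s l)) x =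
    d i (\<lambda>x. of_int (sval s) * (Om j x * h s l x) - (\<Sum>k\<in>UNIV. Gam l j k x * h s k x)) x"
  proof (rule pd_cong[OF _ _ assms])
    show "smooth (\<lambda>x. of_int (sval s) * (Om j x * h s l x) - (\<Sum>k\<in>UNIV. Gam l j k x * h s k x))"
      by (intro smooth_mult smooth_diff smooth_sum smooth_Om smooth_Gam smooth_h smooth_const)
  qed (simp add: pd_h mult.assoc)
  also have "\<dots> = of_int (sval s) * (d i (Om j) x * h s l x + Om j x * d i (h s l) x)
    - (\<Sum>k\<in>UNIV. d i (Gam l j k) x * h s k x + Gam l j k x * d i (h s k) x)"
    using assms by (simp add: pd_sum pd_mult pd_diff smooth_mult smooth_diff smooth_sum smooth_Om
        smooth_Gam smooth_h)
  finally show ?thesis .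
qed

lemma Riem_eq:
  assumes "x \<in> N"
  shows "of_real (riemann g c x l i j k) = d i (Gam l j k) x - d j (Gam l i k) x +
    (\<Sum>m\<in>UNIV. Gam m j k x * Gam l i m x - Gam m i k x * Gam l j m x)"
proof -
  have "d i (Gam l j k) x = of_real (pd c i (\<lambda>y. christoffel g c y l j k) x)" for i l j k
    unfolding Gam_def[abs_def]
    by (rule pd_of_real[OF smooth_of_realD assms]) (use smooth_Gam in \<open>simp add: Gam_def[abs_def]\<close>)
  then show ?thesis by (simp add: riemann_def Gam_def)
qed

text \<open>Second partial derivatives of \<open>h s\<close> commute. Rewriting them twice by
  \<open>pd_h\<close> leaves the curvature against \<open>rho\<close>; the terms quadratic in
  \<open>Om\<close> cancel because each frame vector is only rescaled.\<close>

lemma Riem_h: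
  assumes "x \<in> N"
  shows "(\<Sum>k\<in>UNIV. of_real (riemann g c x l 1 2 k) * h s k x) = of_int (sval s) * rho x * h s l x"
proof -
  have "d 1 (d 2 (h s l)) x - d 2 (d 1 (h s l)) x = 0"
    using pd_commute[OF smooth_h assms] by simp
  then have "of_int (sval s) * rho x * h s l x - (\<Sum>k\<in>UNIV. of_real (riemann g c x l 1 2 k) * h s k x) = 0"
    unfolding pd_pd_h[OF assms] pd_h[OF assms] Riem_eq[OF assms] rho_def
    by (simp add: sum_2 algebra_simps)
  then show ?thesis by simp
qed

text \<open>The coordinate area form on \<open>h Plus\<close>, \<open>h Minus\<close>, so that
  \<open>rho x * area x\<close> is the exterior derivative of \<Omega> evaluated on the
  frame.\<close>

definition area :: "'a \<Rightarrow> complex" where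
  "area x = h Plus 1 x * h Minus 2 x - h Plus 2 x * h Minus 1 x"

text \<open>Expand the second coordinate field in the frame, let the curvature act by
  \<open>Riem_h\<close>, and pair with the first coordinate field: the result must be
  \<open>K\<close> times the determinant.\<close>

lemma rho_area:
  assumes x: "x \<in> N"
  shows "rho x * area x = 2 * of_real K"
proof -
  define lo where "lo s j = (\<Sum>i\<in>UNIV. G j i x * h s i x)" for s j
  define R where "R l k = complex_of_real (riemann g c x l 1 2 k)" for l k
  \<comment> \<open>The coordinate field with index \<open>j\<close> expanded in the frame;
    \<open>lo s j\<close> is its inner product with \<open>h s\<close>.\<close>
  have delta: "(if i = j then 1 else 0) = (lo Minus j * h Plus i x + lo Plus j * h Minus i x) / 2" for i j
    using null_pair_expansion[OF metric_symmetric[OF x] null[OF x], of "\<lambda>i. if i = j then 1 else 0" i]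
    by (simp add: lo_def G_def if_distrib[of "\<lambda>z. _ * z"] if_distrib[of "\<lambda>z. z * _"] sum_2 cong: if_cong)
       (cases "j = 1"; use exhaust_2[of j] in auto)
  have R2: "R l 2 = rho x * (lo Minus 2 * h Plus l x - lo Plus 2 * h Minus l x) / 2" for l
  proof -
    have "R l 2 = (\<Sum>k\<in>UNIV. R l k * (if k = 2 then 1 else 0))"
      by (simp add: sum_2)
    also have "\<dots> = (lo Minus 2 * (\<Sum>k\<in>UNIV. R l k * h Plus k x) + lo Plus 2 * (\<Sum>k\<in>UNIV. R l k * h Minus k x)) / 2"
      unfolding delta by (simp add: sum_2 algebra_simps add_divide_distrib)
    also have "\<dots> = rho x * (lo Minus 2 * h Plus l x - lo Plus 2 * h Minus l x) / 2"
      using Riem_h[OF x, of l Plus] Riem_h[OF x, of l Minus] by (simp add: R_def algebra_simps)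
    finally show ?thesis .
  qed
  define D where "D = lo Minus 2 * lo Plus 1 - lo Plus 2 * lo Minus 1"
  have "of_real K * (of_real (det (g c x))) = (\<Sum>l\<in>UNIV. G l 1 x * R l 2)"
    using arg_cong[OF curvature[OF x], of complex_of_real] by (simp add: G_def R_def)
  also have "\<dots> = rho x * D / 2"
    unfolding R2 D_def by (simp add: lo_def sum_2 G_sym[OF x, of 2 1] algebra_simps add_divide_distrib diff_divide_distrib)
  finally have 1: "of_real K * (of_real (det (g c x))) = rho x * D / 2" .
  \<comment> \<open>Lowering the indices of both frame vectors multiplies their determinant by that
    of the metric, which is then cancelled.\<close>
  have 2: "D = of_real (det (g c x)) * area x"
    by (simp add: D_def lo_def area_def det_2 sum_2 G_def symmetric_nth[OF metric_symmetric[OF x], of 2 1] algebra_simps)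
  have 3: "of_real (det (g c x)) * (area x)\<^sup>2 = -4"
    using null_pair_det[OF metric_symmetric[OF x] null[OF x]] by (simp add: area_def)
  have "of_real (det (g c x)) \<noteq> (0 :: complex)" using 3 by auto
  with 1 2 show ?thesis by (simp add: field_simps)
qed

section \<open>Weighted derivatives along the frame and the Laplacian\<close>

text \<open>The derivative along \<open>h s\<close> of a frame component of weight \<open>w\<close>;
  the \<open>Om\<close> term is the total contribution of the frame vectors occurring in that
  component.\<close>

definition Dop :: "sign \<Rightarrow> int \<Rightarrow> ('a \<Rightarrow> complex) \<Rightarrow> 'a \<Rightarrow> complex" where
  "Dop s w u x = (\<Sum>j\<in>UNIV. h s j x * (d j u x - of_int w * Om j x * u x))"

lemma smooth_Dop: "smooth u \<Longrightarrow> smooth (Dop s w u)"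
  unfolding Dop_def[abs_def]
  by (intro smooth_mult smooth_diff smooth_sum smooth_Om smooth_pd smooth_h smooth_const)

lemma Dop_cong:
  assumes "\<And>x. x \<in> N \<Longrightarrow> u x = v x" "smooth v" "x \<in> N"
  shows "Dop s w u x = Dop s w v x"
  using pd_cong[OF assms] assms by (simp add: Dop_def)

lemma Dop_cmult: "smooth u \<Longrightarrow> x \<in> N \<Longrightarrow> Dop s w (\<lambda>x. a * u x) x = a * Dop s w u x"
  by (simp add: Dop_def pd_mult sum_2 algebra_simps)

lemma pd_Dop:
  assumes "smooth u" "x \<in> N"
  shows "d i (Dop s w u) x = (\<Sum>j\<in>UNIV. d i (h s j) x * (d j u x - of_int w * Om j x * u x) +
    h s j x * (d i (d j u) x - of_int w * (d i (Om j) x * u x + Om j x * d i u x)))"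
  unfolding Dop_def[abs_def] using assms
  by (simp add: pd_sum pd_mult pd_diff smooth_mult smooth_diff smooth_sum smooth_Om smooth_pd
      smooth_h algebra_simps)

text \<open>Differentiating along \<open>h s\<close> changes the weight by \<open>sval s\<close>.
  With these shifts and the symmetric connection all first-order terms cancel, and only
  \<open>w\<close> times the derivative of \<Omega> survives.\<close>

lemma Dop_commutator:
  assumes "smooth u" "x \<in> N"
  shows "Dop Plus (w - 1) (Dop Minus w u) x - Dop Minus (w + 1) (Dop Plus w u) x =
    - 2 * of_int w * of_real K * u x"
proof -
  have "Dop Plus (w - 1) (Dop Minus w u) x - Dop Minus (w + 1) (Dop Plus w u) x =
    - of_int w * (rho x * area x) * u x"
    unfolding Dop_def[of _ _ "Dop _ _ _"] pd_Dop[OF assms] pd_h[OF assms(2)] rho_def area_def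
    using pd_commute[OF assms, of 2 1] Gam_sym[OF assms(2), of _ 2 1]
    by (simp add: Dop_def sum_2 algebra_simps)
  then show ?thesis by (simp add: rho_area[OF assms(2)])
qed

text \<open>The inverse metric in the null frame makes the Laplacian the average of the two orders
  of differentiation; at weight 0 they commute.\<close>

lemma laplacian_eq:
  assumes f: "smooth f" and x: "x \<in> N"
  shows "laplacian g c f x = Dop Plus (-1) (Dop Minus 0 f) x"
proof -
  define X where "X i y = (h Plus i y * Dop Minus 0 f y + h Minus i y * Dop Plus 0 f y) * (1/2)" for i y
  have X: "grad g c f y i = X i y" if "y \<in> N" for y i
    using H_eq[OF that] by (simp add: X_def grad_def Dop_def H_def sum_2 algebra_simps add_divide_distrib)
  have sX: "smooth (X i)" for i
    unfolding X_def by (intro smooth_mult smooth_add smooth_h smooth_Dop f smooth_const)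
  have "laplacian g c f x = (\<Sum>i\<in>UNIV. d i (X i) x + (\<Sum>k\<in>UNIV. Gam i i k x * X k x))"
    unfolding laplacian_def divergence_def using X[OF x] pd_cong[OF X sX x]
    by (simp add: Gam_def)
  also have "\<dots> = (Dop Plus (-1) (Dop Minus 0 f) x + Dop Minus 1 (Dop Plus 0 f) x) / 2"
  proof -
    have dX: "d i (X i) x = (d i (h Plus i) x * Dop Minus 0 f x + h Plus i x * d i (Dop Minus 0 f) x +
      (d i (h Minus i) x * Dop Plus 0 f x + h Minus i x * d i (Dop Plus 0 f) x)) * (1/2)" for i
      unfolding X_def using f x
      by (simp add: pd_mult pd_add smooth_mult smooth_add smooth_h smooth_Dop del: times_divide_eq_right)
    show ?thesis
      unfolding dX pd_h[OF x] by (simp add: X_def Dop_def[of _ _ "Dop _ _ _"] sum_2 field_simps)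
  qed
  also have "\<dots> = Dop Plus (-1) (Dop Minus 0 f) x"
    using Dop_commutator[OF f x, of 0] by simp
  finally show ?thesis .
qed

section \<open>Frame components of iterated covariant derivatives\<close>

text \<open>Contraction with a product of frame vectors, peeled off slot by slot so that induction
  on the word applies; \<open>tcon_contract\<close> identifies it with the sum over index
  lists.\<close>

primrec tcon :: "('a \<Rightarrow> 2 list \<Rightarrow> complex) \<Rightarrow> sign list \<Rightarrow> 'a \<Rightarrow> complex" where
  "tcon T [] x = T x []"
| "tcon T (s # is) x = (\<Sum>b\<in>UNIV. h s b x * tcon (\<lambda>y js. T y (b # js)) is x)"

lemma smooth_tcon: "(\<And>js. smooth (\<lambda>y. T y js)) \<Longrightarrow> smooth (tcon T is)"
proof (induction "is" arbitrary: T)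
  case Nil
  have "tcon T [] = (\<lambda>x. T x [])"
    by (simp add: fun_eq_iff)
  with Nil show ?case by simp
next
  case (Cons s "is")
  have "tcon T (s # is) = (\<lambda>x. \<Sum>b\<in>UNIV. h s b x * tcon (\<lambda>y js. T y (b # js)) is x)"
    by (simp add: fun_eq_iff)
  moreover have "smooth (\<lambda>x. \<Sum>b\<in>UNIV. h s b x * tcon (\<lambda>y js. T y (b # js)) is x)"
    by (intro smooth_sum smooth_mult smooth_h Cons)
  ultimately show ?case by simp
qed

lemma tcon_diff:
  "tcon (\<lambda>y js. T y js - (\<Sum>a\<in>(UNIV :: 2 set). \<phi> a y * T' a y js)) is x =
    tcon T is x - (\<Sum>a\<in>UNIV. \<phi> a x * tcon (T' a) is x)"
proof (induction "is" arbitrary: T T')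
  case (Cons s "is")
  note IH = Cons[of "\<lambda>y js. T y (b # js)" "\<lambda>a y js. T' a y (b # js)" for b]
  show ?case unfolding tcon.simps IH by (simp add: sum_2 algebra_simps)
qed simp

text \<open>Separates the connection term of the first slot of \<open>T\<close> from the others,
  matching the recursion of \<open>tcon\<close>.\<close>

lemma cov_deriv_Cons:
  "cov_deriv g c T x (j # b # js) =
    cov_deriv g c (\<lambda>y js. T y (b # js)) x (j # js) - (\<Sum>a\<in>UNIV. Gam a j b x * T x (a # js))"
  by (simp add: cov_deriv_def Gam_def sum.lessThan_Suc_shift del: sum.lessThan_Suc)

text \<open>As \<open>\<nabla>h\<^sub>\<plusminus> = \<plusminus>Om h\<^sub>\<plusminus>\<close>, the connection terms of the frame vectors add up to the weight.\<close>

lemma tcon_cov_deriv: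
  assumes "\<And>js. smooth (\<lambda>y. T y js)" "x \<in> N"
  shows "tcon (\<lambda>y js. cov_deriv g c T y (j # js)) is x =
    d j (tcon T is) x - of_int (weight is) * Om j x * tcon T is x"
  using assms(1)
proof (induction "is" arbitrary: T)
  case Nil
  have "tcon T [] = (\<lambda>y. T y [])" by (simp add: fun_eq_iff)
  then show ?case by (simp add: cov_deriv_def)
next
  case (Cons s "is")
  define U where "U b = tcon (\<lambda>y js. T y (b # js)) is" for b
  have U: "smooth (U b)" for b unfolding U_def by (intro smooth_tcon Cons)
  have "tcon T (s # is) = (\<lambda>x. \<Sum>b\<in>UNIV. h s b x * U b x)"
    by (simp add: fun_eq_iff U_def)
  then have dU: "d j (tcon T (s # is)) x = (\<Sum>b\<in>UNIV. d j (h s b) x * U b x + h s b x * d j (U b) x)"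
    using assms(2) U by (simp add: pd_sum pd_mult smooth_mult smooth_h)
  have "tcon (\<lambda>y js. cov_deriv g c T y (j # js)) (s # is) x =
    (\<Sum>b\<in>UNIV. h s b x * (d j (U b) x - of_int (weight is) * Om j x * U b x -
       (\<Sum>a\<in>UNIV. Gam a j b x * U a x)))"
    by (simp add: cov_deriv_Cons tcon_diff Cons U_def)
  also have "\<dots> = d j (tcon T (s # is)) x - of_int (weight (s # is)) * Om j x * (\<Sum>b\<in>UNIV. h s b x * U b x)"
    unfolding dU pd_h[OF assms(2)] by (simp add: sum_2 algebra_simps)
  also have "(\<Sum>b\<in>UNIV. h s b x * U b x) = tcon T (s # is) x"
    by (simp add: U_def)
  finally show ?case .
qed

lemma smooth_nabla:
  assumes "smooth f"
  shows "smooth (\<lambda>y. nabla_fun g c n f y js)"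
proof (induction n arbitrary: js)
  case 0
  then show ?case using assms by (simp add: nabla_fun_def)
next
  case (Suc n)
  show ?case
  proof (cases js)
    case Nil
    then show ?thesis by (simp add: nabla_fun_def cov_deriv_def)
  next
    case (Cons j "is")
    have "smooth (\<lambda>y. pd c j (\<lambda>y. nabla_fun g c n f y is) y -
     (\<Sum>m<length is. \<Sum>a\<in>UNIV. Gam a j (is ! m) y * nabla_fun g c n f y (is[m := a])))"
      by (intro smooth_diff smooth_pd smooth_sum smooth_mult smooth_Gam Suc)
    then show ?thesis by (simp add: Cons nabla_fun_def cov_deriv_def Gam_def)
  qed
qed

definition W :: "('a \<Rightarrow> complex) \<Rightarrow> sign list \<Rightarrow> 'a \<Rightarrow> complex" where
  "W f is = tcon (nabla_fun g c (length is) f) is"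

lemma smooth_W: "smooth f \<Longrightarrow> smooth (W f is)"
  unfolding W_def by (intro smooth_tcon smooth_nabla)

lemma W_Nil [simp]: "W f [] = f"
  by (simp add: W_def nabla_fun_def fun_eq_iff)

lemma W_Cons:
  assumes "smooth f" "x \<in> N"
  shows "W f (s # is) x = Dop s (weight is) (W f is) x"
  unfolding W_def
  using tcon_cov_deriv[where T = "nabla_fun g c (length is) f",
      OF smooth_nabla[OF assms(1)] assms(2), of _ "is"]
  by (simp add: Dop_def nabla_fun_def)

lemma W_Cons_Cons:
  assumes "smooth f" "x \<in> N"
  shows "W f (s # s' # is) x = Dop s (sval s' + weight is) (Dop s' (weight is) (W f is)) x"
  using Dop_cong[OF W_Cons[OF assms(1)] smooth_Dop[OF smooth_W[OF assms(1)]] assms(2)] assms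
  by (simp add: W_Cons)

text \<open>This is \<open>Dop_commutator\<close> at the weight of the tail; \<open>sval s\<close>
  merges the two orders into one formula.\<close>

lemma W_swap:
  assumes "smooth f" "x \<in> N"
  shows "W f (opp s # s # is) x =
    W f (s # opp s # is) x + 2 * of_int (sval s * weight is) * of_real K * W f is x"
proof -
  have "W f (Plus # Minus # is) x - W f (Minus # Plus # is) x =
      - 2 * of_int (weight is) * of_real K * W f is x"
    using Dop_commutator[OF smooth_W[OF assms(1)] assms(2), of "weight is" "is"]
    by (simp add: W_Cons_Cons[OF assms] add.commute)
  then show ?thesis by (cases s) (simp_all add: algebra_simps)
qed

text \<open>Swap the opposite letter with the first \<open>s\<close>, apply the induction hypothesis
  under the outer derivative, and add the curvature term of the swap.\<close>

lemma W_opp_replicate: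
  assumes f: "smooth f" and ev: "\<And>x. x \<in> N \<Longrightarrow> - laplacian g c f x = \<mu> * f x" and "x \<in> N"
  shows "W f (opp s # replicate (Suc k) s) x =
    (of_nat (Suc k) * of_nat k * of_real K - \<mu>) * W f (replicate k s) x"
  using assms(3)
proof (induction k arbitrary: x)
  case 0
  have "W f [Plus, Minus] x = - \<mu> * f x"
    using laplacian_eq[OF f 0] ev[OF 0] by (simp add: W_Cons_Cons[OF f 0] minus_equation_iff)
  then show ?case using W_swap[OF f 0, of Plus "[]"] by (cases s) auto
next
  case (Suc k)
  define a where "a = of_nat (Suc k) * of_nat k * of_real K - \<mu>"
  \<comment> \<open>The induction hypothesis holds on all of \<open>N\<close>, so it may be
    differentiated; this is why the point is generalised.\<close>
  have "W f (s # opp s # replicate (Suc k) s) x =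
      Dop s (weight (opp s # replicate (Suc k) s)) (\<lambda>x. a * W f (replicate k s) x) x"
    unfolding W_Cons[OF f Suc.prems, of s "opp s # replicate (Suc k) s"] a_def
    by (rule Dop_cong[OF Suc.IH _ Suc.prems], assumption, intro smooth_mult smooth_const smooth_W f)
  also have "weight (opp s # replicate (Suc k) s) = weight (replicate k s)"
    by (cases s) auto
  also have "Dop s (weight (replicate k s)) (\<lambda>x. a * W f (replicate k s) x) x = a * W f (replicate (Suc k) s) x"
    using Suc.prems by (simp add: Dop_cmult smooth_W f W_Cons)
  finally have "W f (opp s # s # replicate (Suc k) s) x = a * W f (replicate (Suc k) s) x +
      2 * of_int (sval s * weight (replicate (Suc k) s)) * of_real K * W f (replicate (Suc k) s) x"
    using W_swap[OF f Suc.prems, of s "replicate (Suc k) s"] by simp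
  also have "sval s * weight (replicate (Suc k) s) = int (Suc k)"
    unfolding weight_replicate using sval_sq[of s] by (simp add: algebra_simps)
  \<comment> \<open>Here \<open>(k + 1) k + 2 (k + 1) = (k + 2) (k + 1)\<close>.\<close>
  also have "a * W f (replicate (Suc k) s) x +
      2 * of_int (int (Suc k)) * of_real K * W f (replicate (Suc k) s) x =
      (of_nat (Suc (Suc k)) * of_nat (Suc k) * of_real K - \<mu>) * W f (replicate (Suc k) s) x"
    by (simp add: a_def algebra_simps)
  finally show ?case by simp
qed

end

section \<open>The eigenvalue polynomial\<close>

text \<open>The coefficient of \<open>W_opp_replicate\<close> with \<open>Suc k\<close> equal to the
  absolute value of \<open>w\<close>, as a polynomial in the eigenvalue.\<close>

definition step_factor :: "real \<Rightarrow> int \<Rightarrow> complex poly" where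
  "step_factor K w = [:of_int (\<bar>w\<bar> * (\<bar>w\<bar> - 1)) * of_real K, -1:]"

text \<open>The head of a word is the outermost derivative, so the recursion follows the order of
  differentiation. The sign condition says that the new letter moves the weight towards 0.\<close>

primrec eig_poly :: "real \<Rightarrow> sign list \<Rightarrow> complex poly" where
  "eig_poly K [] = 1"
| "eig_poly K (s # is) =
    (if sval s * weight is < 0 then step_factor K (weight is) else 1) * eig_poly K is"

text \<open>The shortest word of weight \<open>w\<close>, serving as normal form; it is empty for
  weight 0.\<close>

definition top_word :: "int \<Rightarrow> sign list" where
  "top_word w = replicate (nat \<bar>w\<bar>) (if w \<ge> 0 then Plus else Minus)"

lemma weight_top_word [simp]: "weight (top_word w) = w"
  by (simp add: top_word_def)

lemma poly_step_factor:
  "poly (step_factor K (int q)) z = of_nat q * (of_nat q - 1) * of_real K - z"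
  "poly (step_factor K (- int q)) z = of_nat q * (of_nat q - 1) * of_real K - z"
  by (simp_all add: step_factor_def)

lemma weight_count: "weight is = int (count_list is Plus) - int (count_list is Minus)"
proof (induction "is")
  case (Cons s "is")
  then show ?case by (cases s) auto
qed simp

text \<open>A root comes from some factor, hence from a tail of nonzero weight. That weight is a
  difference of two letter counts, each at most \<open>r\<close>, so its absolute value lies between
  1 and \<open>r\<close>.\<close>

lemma eig_poly_roots:
  assumes "poly (eig_poly K is) z = 0" "count_list is Plus \<le> r" "count_list is Minus \<le> r"
  shows "\<exists>q\<in>{1..r}. z = of_nat q * (of_nat q - 1) * of_real K"
  using assms
proof (induction "is")
  case (Cons s "is")
  have c: "count_list is Plus \<le> r" "count_list is Minus \<le> r"
    using Cons.prems by (auto split: if_splits)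
  show ?case
  proof (cases "poly (eig_poly K is) z = 0")
    case False
    with Cons.prems(1) have n: "sval s * weight is < 0" and z: "poly (step_factor K (weight is)) z = 0"
      by (auto split: if_splits)
    define q where "q = nat \<bar>weight is\<bar>"
    have "weight is = int q \<or> weight is = - int q" by (auto simp: q_def)
    then have "z = of_nat q * (of_nat q - 1) * of_real K"
      using z poly_step_factor[of K q z] by auto
    moreover have "weight is \<noteq> 0" using n by auto
    then have "q \<in> {1..r}" using c weight_count[of "is"] by (auto simp: q_def)
    ultimately show ?thesis by blast
  qed (use Cons.IH c in blast)
qed simp

text \<open>A word whose weight drops from at least \<open>q\<close> to below \<open>q\<close> in absolute value
  passes through a descent from \<open>q\<close> to \<open>q - 1\<close>.\<close>

lemma eig_poly_descent:
  assumes "\<bar>weight base\<bar> \<ge> int q" "\<bar>weight (pre @ base)\<bar> < int q"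
  shows "poly (eig_poly K (pre @ base)) (of_nat q * (of_nat q - 1) * of_real K) = 0"
  using assms(2)
proof (induction pre)
  case Nil
  then show ?case using assms(1) by simp
next
  case (Cons s pre)
  let ?w = "weight (pre @ base)"
  show ?case
  proof (cases "\<bar>?w\<bar> < int q")
    case False
    then have "sval s * ?w < 0" "?w = int q \<or> ?w = - int q"
      using Cons.prems by (cases s; auto)+
    then show ?thesis
      using poly_step_factor[of K q] by auto
  qed (use Cons.IH in simp)
qed

section \<open>Products of null vectors at a point\<close>

definition tens :: "(sign \<Rightarrow> 2 \<Rightarrow> complex) \<Rightarrow> sign list \<Rightarrow> 2 list \<Rightarrow> complex" where
  "tens k is js = (\<Prod>m<length is. k (is ! m) (js ! m))"

lemma tens_Nil [simp]: "tens k [] js = 1"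
  by (simp add: tens_def)

lemma tens_Cons [simp]: "tens k (s # is) (j # js) = k s j * tens k is js"
  by (simp add: tens_def prod.lessThan_Suc_shift del: prod.lessThan_Suc)

lemma sum_lists_Suc:
  fixes F :: "'n::finite list \<Rightarrow> 'b::comm_monoid_add"
  shows "(\<Sum>js | length js = Suc n. F js) = (\<Sum>b\<in>UNIV. \<Sum>js | length js = n. F (b # js))"
proof -
  have "{js :: 'n list. length js = Suc n} = (\<lambda>(b, js). b # js) ` (UNIV \<times> {js. length js = n})"
    by (auto simp: length_Suc_conv)
  moreover have inj: "inj_on (\<lambda>(b, js :: 'n list). b # js) (UNIV \<times> {js. length js = n})"
    by (auto simp: inj_on_def)
  ultimately have "(\<Sum>js | length js = Suc n. F js) =
      sum (F \<circ> (\<lambda>(b, js). b # js)) (UNIV \<times> {js. length js = n})"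
    using sum.reindex[OF inj, of F] by simp
  then show ?thesis
    by (simp add: sum.cartesian_product o_def split_def)
qed

text \<open>The distributive law in the form that lets a change of coordinates act factor by factor
  on a product tensor.\<close>

lemma prod_sum_lists:
  fixes f :: "nat \<Rightarrow> 'n::finite \<Rightarrow> 'b::comm_semiring_1"
  shows "(\<Prod>m<n. \<Sum>b\<in>UNIV. f m b) = (\<Sum>ks | length ks = n. \<Prod>m<n. f m (ks ! m))"
proof (induction n arbitrary: f)
  case (Suc n)
  show ?case
    unfolding sum_lists_Suc prod.lessThan_Suc_shift
    by (simp add: Suc[of "\<lambda>m. f (Suc m)"] sum_distrib_left sum_distrib_right del: prod.lessThan_Suc)
       (rule sum.swap)
qed simp

lemma finite_lists_of_length: "finite {js :: 'n::finite list. length js = n}"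
  using finite_lists_length_eq[of "UNIV :: 'n set" n] by simp

text \<open>Each letter contributes \<open>u\<close> or its inverse; at weight 0 the reciprocal
  scaling thus disappears.\<close>

lemma tens_scale:
  assumes "length js = length is" "\<And>s j. k s j = u powi sval s * h s j" "u \<noteq> 0"
  shows "tens k is js = u powi weight is * tens h is js"
  using assms(1)
  by (induction js "is" rule: list_induct2) (auto simp: assms(2,3) power_int_add)

context null_frame
begin

text \<open>Reduce the tail to its normal form and differentiate. The new letter either cancels
  against the normal form, by \<open>W_opp_replicate\<close>, or lengthens it.\<close>

lemma W_eq_eig_poly:
  assumes f: "smooth f" and ev: "\<And>x. x \<in> N \<Longrightarrow> - laplacian g c f x = \<mu> * f x" and "x \<in> N"
  shows "W f is x = poly (eig_poly K is) \<mu> * W f (top_word (weight is)) x"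
  using assms(3)
proof (induction "is" arbitrary: x)
  case Nil
  then show ?case by (simp add: top_word_def)
next
  case (Cons s "is")
  define w where "w = weight is"
  have "W f (s # is) x = Dop s w (\<lambda>x. poly (eig_poly K is) \<mu> * W f (top_word w) x) x"
    unfolding W_Cons[OF f Cons.prems] w_def
    by (rule Dop_cong[OF Cons.IH _ Cons.prems], assumption, intro smooth_mult smooth_const smooth_W f)
  also have "\<dots> = poly (eig_poly K is) \<mu> * W f (s # top_word w) x"
    using Cons.prems by (simp add: Dop_cmult smooth_W f W_Cons)
  also have "W f (s # top_word w) x =
      (if sval s * w < 0 then poly (step_factor K w) \<mu> else 1) * W f (top_word (sval s + w)) x"
  proof (cases "sval s * w < 0")
    case True
    \<comment> \<open>In this case \<open>top_word w\<close> consists of \<open>Suc k\<close>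
      letters opposite to \<open>s\<close>, and one of them is cancelled.\<close>
    define k where "k = nat (\<bar>w\<bar> - 1)"
    from True have w: "w = - (sval s * int (Suc k))"
      by (cases s) (auto simp: k_def)
    have t: "top_word w = replicate (Suc k) (opp s)" "W f (top_word (sval s + w)) = W f (replicate k (opp s))"
      unfolding w by (cases s; cases k; auto simp: top_word_def nat_add_distrib)+
    have "poly (step_factor K w) \<mu> = of_nat (Suc k) * of_nat k * of_real K - \<mu>"
      using poly_step_factor[of K "Suc k" \<mu>] unfolding w by (cases s) (auto simp: add.commute)
    moreover have "s = opp (opp s)" by (cases s) auto
    ultimately show ?thesis
      using True W_opp_replicate[OF f ev Cons.prems, of "opp s" k] t by simp
  next
    case False
    \<comment> \<open>Either \<open>s\<close> has the sign of \<open>w\<close>, or \<open>w\<close>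
      is 0 and the empty normal form fits both signs.\<close>
    then have "nat \<bar>sval s + w\<bar> = Suc (nat \<bar>w\<bar>)" and "top_word w = replicate (nat \<bar>w\<bar>) s"
      by (cases s; cases "w = 0"; auto simp: top_word_def)+
    then have "s # top_word w = top_word (sval s + w)"
      using False by (cases s) (auto simp: top_word_def)
    then show ?thesis using False by simp
  qed
  finally show ?case by (simp add: w_def)
qed

lemma tcon_contract:
  "contract (length is) (T x) (tens (\<lambda>s j. h s j x) is) = tcon T is x"
proof (induction "is" arbitrary: T)
  case Nil
  have "{js :: 2 list. length js = 0} = {[]}" by auto
  then show ?case by (simp add: contract_def)
next
  case (Cons s "is")
  note IH = Cons[of "\<lambda>y js. T y (b # js)" for b, symmetric]
  show ?case
    unfolding tcon.simps IH
    by (simp add: contract_def sum_lists_Suc sum_distrib_left mult_ac)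
qed

lemma contract_nabla:
  assumes "smooth f" "\<And>x. x \<in> N \<Longrightarrow> - laplacian g c f x = \<mu> * f x" "x \<in> N" "weight is = 0"
  shows "contract (length is) (nabla_fun g c (length is) f x) (tens (\<lambda>s j. h s j x) is) =
    poly (eig_poly K is) \<mu> * f x"
  unfolding tcon_contract W_def[symmetric]
  using W_eq_eig_poly[OF assms(1-3), of "is"] assms(4) by (simp add: top_word_def)

section \<open>Frame tensors of weight 0 are parallel\<close>

text \<open>The covariant derivative of a contravariant tensor field, hence the plus sign, opposite
  to \<open>cov_deriv\<close>; it is the left side of the equation in
  \<open>parallel_section\<close>.\<close>

definition covtens :: "2 \<Rightarrow> ('a \<Rightarrow> 2 list \<Rightarrow> complex) \<Rightarrow> 2 list \<Rightarrow> 'a \<Rightarrow> complex" where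
  "covtens j T js x = d j (\<lambda>y. T y js) x +
    (\<Sum>m<length js. \<Sum>a\<in>UNIV. Gam (js ! m) j a x * T x (js[m := a]))"

abbreviation frame_tensor :: "sign list \<Rightarrow> 'a \<Rightarrow> 2 list \<Rightarrow> complex" where
  "frame_tensor is x js \<equiv> tens (\<lambda>s j. h s j x) is js"

lemma smooth_frame_tensor: "smooth (\<lambda>x. frame_tensor is x js)"
  unfolding tens_def by (intro smooth_prod smooth_h)

text \<open>Leibniz rule: every factor contributes plus or minus \<open>Om\<close>, and these signs
  add up to the weight.\<close>

lemma covtens_frame_tensor:
  assumes "x \<in> N" "length js = length is"
  shows "covtens j (frame_tensor is) js x = of_int (weight is) * Om j x * frame_tensor is x js"
  using assms(2)
proof (induction js "is" rule: list_induct2)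
  case Nil
  then show ?case by (simp add: covtens_def)
next
  case (Cons b js s "is")
  have "covtens j (frame_tensor (s # is)) (b # js) x =
     (d j (h s b) x + (\<Sum>a\<in>UNIV. Gam b j a x * h s a x)) * frame_tensor is x js +
     h s b x * covtens j (frame_tensor is) js x"
    using assms(1)
    by (simp add: covtens_def sum.lessThan_Suc_shift pd_mult smooth_h smooth_frame_tensor
        sum_distrib_left sum_distrib_right algebra_simps del: sum.lessThan_Suc)
  then show ?case
    unfolding Cons.IH pd_h[OF assms(1)] by (simp add: algebra_simps)
qed

text \<open>Covers the second alternative of \<open>null_pair_unique\<close>, where a null pair
  matches the frame only after exchange.\<close>

lemma null_frame_opp: "null_frame c N g (\<lambda>s. h (opp s)) K"
proof
  show "transpose (g c x) = g c x" if "x \<in> N" for x by (rule metric_symmetric[OF that])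
  show "smooth (\<lambda>x. g c x $ i $ j)" for i j by (rule smooth_metric)
  show "smooth (h (opp s) i)" for s i by (rule smooth_h)
  show "null_pair (g c x) (\<lambda>s j. h (opp s) j x)" if "x \<in> N" for x
  proof -
    have "opp s = opp s' \<longleftrightarrow> s = s'" for s s' by (cases s; cases s') auto
    then show ?thesis using null[OF that] by (simp add: null_pair_def)
  qed
  show "(\<Sum>l\<in>UNIV. g c x $ l $ 1 * riemann g c x l 1 2 2) = K * det (g c x)" if "x \<in> N" for x
    by (rule curvature[OF that])
qed

end

section \<open>Uniqueness of parallel tensors\<close>

text \<open>Gronwall argument for the energy \<phi>, the sum of squared norms: its derivative is at
  most \<open>B\<close> times \<phi>, so \<phi> damped by an exponential cannot increase from its
  initial value 0.\<close>

lemma linear_ode_zero: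
  fixes F F' :: "'i \<Rightarrow> real \<Rightarrow> complex"
  assumes "finite I"
    and der: "\<And>i t. i \<in> I \<Longrightarrow> 0 \<le> t \<Longrightarrow> t \<le> 1 \<Longrightarrow> (F i has_vector_derivative F' i t) (at t)"
    and bound: "\<And>i t. i \<in> I \<Longrightarrow> 0 \<le> t \<Longrightarrow> t \<le> 1 \<Longrightarrow> norm (F' i t) \<le> C * (\<Sum>k\<in>I. norm (F k t))"
    and "C \<ge> 0" and zero: "\<And>i. i \<in> I \<Longrightarrow> F i 0 = 0" and "i \<in> I"
  shows "F i 1 = 0"
proof -
  define \<phi> where "\<phi> t = (\<Sum>i\<in>I. (norm (F i t))\<^sup>2)" for t
  \<comment> \<open>The factor \<open>card I\<close> comes from bounding the square of the sum of
    norms by the sum of their squares.\<close>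
  define B where "B = 2 * C * real (card I)"
  have der_\<phi>: "(\<phi> has_real_derivative (\<Sum>i\<in>I. 2 * (F i t \<bullet> F' i t))) (at t)" if "0 \<le> t" "t \<le> 1" for t
  proof -
    have "((\<lambda>t. F i t \<bullet> F i t) has_real_derivative 2 * (F i t \<bullet> F' i t)) (at t)" if "i \<in> I" for i
    proof -
      note D = der[OF \<open>i \<in> I\<close> \<open>0 \<le> t\<close> \<open>t \<le> 1\<close>, unfolded has_vector_derivative_def]
      have "((\<lambda>t. F i t \<bullet> F i t) has_derivative (\<lambda>s. F i t \<bullet> (s *\<^sub>R F' i t) + (s *\<^sub>R F' i t) \<bullet> F i t)) (at t)"
        by (rule has_derivative_inner[OF D D])
      then show ?thesis
        by (simp add: has_field_derivative_def inner_commute[of "F' i t"] mult_commute_abs algebra_simps)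
    qed
    then show ?thesis unfolding \<phi>_def power2_norm_eq_inner by (intro DERIV_sum) auto
  qed
  have le: "(\<Sum>i\<in>I. 2 * (F i t \<bullet> F' i t)) \<le> B * \<phi> t" if "0 \<le> t" "t \<le> 1" for t
  proof -
    let ?S = "\<Sum>k\<in>I. norm (F k t)"
    have "(\<Sum>i\<in>I. 2 * (F i t \<bullet> F' i t)) \<le> (\<Sum>i\<in>I. 2 * (norm (F i t) * (C * ?S)))"
    proof (rule sum_mono)
      fix i assume i: "i \<in> I"
      have "F i t \<bullet> F' i t \<le> norm (F i t) * norm (F' i t)" by (rule norm_cauchy_schwarz)
      also have "\<dots> \<le> norm (F i t) * (C * ?S)"
        using bound[OF i that] by (intro mult_left_mono) auto
      finally show "2 * (F i t \<bullet> F' i t) \<le> 2 * (norm (F i t) * (C * ?S))" by simp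
    qed
    also have "\<dots> = 2 * C * ?S\<^sup>2"
      by (simp add: sum_distrib_left[symmetric] sum_distrib_right[symmetric] power2_eq_square)
    also have "\<dots> \<le> 2 * C * ((\<Sum>i\<in>I. (norm (F i t))\<^sup>2) * card I)"
      using \<open>C \<ge> 0\<close> by (intro mult_left_mono sum_squared_le_sum_of_squares) auto
    finally show ?thesis by (simp add: B_def \<phi>_def mult_ac)
  qed
  have "\<phi> 0 * exp (- B * 0) \<ge> \<phi> 1 * exp (- B * 1)"
  proof (rule DERIV_nonpos_imp_nonincreasing[where f = "\<lambda>t. \<phi> t * exp (- B * t)"])
    show "\<exists>y. ((\<lambda>t. \<phi> t * exp (- B * t)) has_real_derivative y) (at t) \<and> y \<le> 0" if "0 \<le> t" "t \<le> 1" for t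
    proof (intro exI conjI)
      show "((\<lambda>t. \<phi> t * exp (- B * t)) has_real_derivative
          ((\<Sum>i\<in>I. 2 * (F i t \<bullet> F' i t)) - B * \<phi> t) * exp (- B * t)) (at t)"
        by (rule derivative_eq_intros der_\<phi> that refl)+ (simp add: algebra_simps)
      show "((\<Sum>i\<in>I. 2 * (F i t \<bullet> F' i t)) - B * \<phi> t) * exp (- B * t) \<le> 0"
        using le[OF that] by (simp add: mult_le_0_iff)
    qed
  qed simp
  moreover have "\<phi> 0 = 0" using zero by (simp add: \<phi>_def)
  ultimately have "\<phi> 1 \<le> 0" by (simp add: mult_le_0_iff)
  moreover have "\<phi> 1 \<ge> 0" by (simp add: \<phi>_def sum_nonneg)
  ultimately have "\<phi> 1 = 0" by simp
  then show ?thesis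
    using assms(1) \<open>i \<in> I\<close> by (simp add: \<phi>_def sum_nonneg_eq_0_iff)
qed

context null_frame
begin

text \<open>Along the straight coordinate segment from \<open>y\<close> to \<open>z\<close> the
  components of a parallel tensor solve a homogeneous linear system with coefficients from the
  Christoffel symbols.\<close>

lemma parallel_zero:
  assumes conv: "convex (chart_map c ` N)"
    and sm: "\<And>js. length js = k \<Longrightarrow> smooth (\<lambda>x. T x js)"
    and par: "\<And>j js x. length js = k \<Longrightarrow> x \<in> N \<Longrightarrow> covtens j T js x = 0"
    and y: "y \<in> N" and z: "z \<in> N"
    and zero: "\<And>js. length js = k \<Longrightarrow> T y js = 0" and "length js = k"
  shows "T z js = 0"
proof -
  define v where "v = chart_map c z - chart_map c y"
  define \<gamma> where "\<gamma> t = chart_inv c (chart_map c y + t *\<^sub>R v)" for t :: real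
  have seg: "chart_map c y + t *\<^sub>R v \<in> chart_map c ` N" if "0 \<le> t" "t \<le> 1" for t
  proof -
    have "(1 - t) *\<^sub>R chart_map c y + t *\<^sub>R chart_map c z \<in> chart_map c ` N"
      using conv y z that by (intro convexD) auto
    then show ?thesis by (simp add: v_def algebra_simps)
  qed
  have \<gamma>: "\<gamma> t \<in> N" "chart_map c (\<gamma> t) = chart_map c y + t *\<^sub>R v" if "0 \<le> t" "t \<le> 1" for t
    using seg[OF that] by (auto simp: \<gamma>_def)
  \<comment> \<open>One bound for all symbols: the sum of their norms is continuous on a compact
    interval.\<close>
  obtain B where B: "\<And>l i j t. 0 \<le> t \<Longrightarrow> t \<le> 1 \<Longrightarrow> norm (Gam l i j (\<gamma> t)) \<le> B"
  proof -
    define \<psi> where "\<psi> t = (\<Sum>(l, i, j)\<in>UNIV. norm (Gam l i j (\<gamma> t)))" for t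
    have "continuous_on {0..1} (\<lambda>t. Gam l i j (\<gamma> t))" for l i j
    proof -
      have "continuous_on {0..1} ((Gam l i j \<circ> chart_inv c) \<circ> (\<lambda>t. chart_map c y + t *\<^sub>R v))"
      proof (rule continuous_on_compose)
        show "continuous_on {0..1} (\<lambda>t. chart_map c y + t *\<^sub>R v)"
          by (intro continuous_intros)
        show "continuous_on ((\<lambda>t. chart_map c y + t *\<^sub>R v) ` {0..1}) (Gam l i j \<circ> chart_inv c)"
          by (rule continuous_on_subset[OF smooth_on_imp_continuous_on[OF smooth_Gam[unfolded smooth_def]]])
            (use seg in auto)
      qed
      then show ?thesis by (simp add: \<gamma>_def o_def)
    qed
    then have "continuous_on {0..1} \<psi>"
      unfolding \<psi>_def by (intro continuous_on_sum) (auto intro!: continuous_intros)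
    then have "bounded (\<psi> ` {0..1})"
      by (intro compact_imp_bounded compact_continuous_image) auto
    then obtain B where B: "\<And>t. t \<in> {0..1} \<Longrightarrow> norm (\<psi> t) \<le> B"
      unfolding bounded_iff by blast
    have le: "norm (Gam l i j (\<gamma> t)) \<le> \<psi> t" for l i j t
      unfolding \<psi>_def
      using member_le_sum[of "(l, i, j)" UNIV "\<lambda>(l, i, j). norm (Gam l i j (\<gamma> t))"] by auto
    have "norm (Gam l i j (\<gamma> t)) \<le> B" if "0 \<le> t" "t \<le> 1" for l i j t
      using le[of l i j t] B[of t] that by auto
    then show thesis by (rule that)
  qed
  have "B \<ge> 0" by (rule order_trans[OF norm_ge_zero B[of 0]]) auto
  define I where "I = {js :: 2 list. length js = k}"
  have fin: "finite I" unfolding I_def by (rule finite_lists_of_length)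
  define F where "F js t = T (\<gamma> t) js" for js t
  define F' where "F' js t = (\<Sum>j\<in>UNIV. of_real (v $ j) * d j (\<lambda>x. T x js) (\<gamma> t))" for js t
  \<comment> \<open>What remains after each component norm in the system is bounded by the sum of
    all of them.\<close>
  define C where "C = (\<Sum>j\<in>(UNIV :: 2 set). \<Sum>m<k. \<Sum>a\<in>(UNIV :: 2 set). \<bar>v $ j\<bar> * B)"
  have "F js 1 = 0"
  proof (rule linear_ode_zero[OF fin, of F F' C])
    fix ks t assume ks: "ks \<in> I" and t: "0 \<le> t" "(t :: real) \<le> 1"
    let ?D = "frechet_derivative ((\<lambda>x. T x ks) \<circ> chart_inv c) (at (chart_map c (\<gamma> t)))"
    have D: "((\<lambda>y. T (chart_inv c y) ks) has_derivative ?D) (at (chart_map c y + t *\<^sub>R v))"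
      using smooth_has_derivative[OF sm \<gamma>(1)[OF t], of ks] ks \<gamma>(2)[OF t] by (simp add: I_def)
    have lin: "linear ?D" using has_derivative_linear[OF D] .
    have "((\<lambda>t. chart_map c y + t *\<^sub>R v) has_derivative (\<lambda>s. s *\<^sub>R v)) (at t)"
      by (auto intro!: derivative_eq_intros)
    from has_derivative_compose[OF this D]
    have "(F ks has_derivative (\<lambda>s. ?D (s *\<^sub>R v))) (at t)" by (simp add: F_def[abs_def] \<gamma>_def)
    moreover have "?D v = F' ks t"
    proof -
      have "?D v = ?D (\<Sum>j\<in>UNIV. v $ j *\<^sub>R axis j 1)"
        using basis_expansion[of v] by (intro arg_cong[of _ _ ?D]) (simp add: scalar_mult_eq_scaleR)
      also have "\<dots> = (\<Sum>j\<in>UNIV. v $ j *\<^sub>R ?D (axis j 1))"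
        using lin by (simp add: linear_sum linear_cmul)
      finally show ?thesis
        by (simp add: F'_def pd_def scaleR_conv_of_real)
    qed
    ultimately show "(F ks has_vector_derivative F' ks t) (at t)"
      by (simp add: has_vector_derivative_def linear_cmul[OF lin])
    let ?S = "\<Sum>k\<in>I. norm (F k t)"
    have len: "length ks = k" using ks by (simp add: I_def)
    have F': "F' ks t = (\<Sum>j\<in>UNIV. \<Sum>m<k. \<Sum>a\<in>UNIV.
        - of_real (v $ j) * Gam (ks ! m) j a (\<gamma> t) * F (ks[m := a]) t)"
    proof -
      have "d j (\<lambda>x. T x ks) (\<gamma> t) =
          - (\<Sum>m<k. \<Sum>a\<in>UNIV. Gam (ks ! m) j a (\<gamma> t) * F (ks[m := a]) t)" for j
        using par[OF len \<gamma>(1)[OF t], of j] len by (simp add: covtens_def F_def eq_neg_iff_add_eq_0)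
      then show ?thesis
        by (simp add: F'_def sum_distrib_left sum_negf mult.assoc del: sum.lessThan_Suc)
    qed
    have "norm (F' ks t) \<le> (\<Sum>j\<in>UNIV. \<Sum>m<k. \<Sum>a\<in>UNIV.
        norm (- of_real (v $ j) * Gam (ks ! m) j a (\<gamma> t) * F (ks[m := a]) t))"
      unfolding F' by (intro sum_norm_le order_refl)
    also have "\<dots> \<le> (\<Sum>j\<in>(UNIV :: 2 set). \<Sum>m<k. \<Sum>a\<in>(UNIV :: 2 set). \<bar>v $ j\<bar> * B * ?S)"
    proof (intro sum_mono)
      fix j a :: 2 and m
      have "norm (F (ks[m := a]) t) \<le> ?S"
        using fin len by (intro member_le_sum) (auto simp: I_def)
      then show "norm (- of_real (v $ j) * Gam (ks ! m) j a (\<gamma> t) * F (ks[m := a]) t) \<le> \<bar>v $ j\<bar> * B * ?S"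
        using B[OF t] \<open>B \<ge> 0\<close> unfolding norm_mult by (intro mult_mono) auto
    qed
    also have "\<dots> = C * ?S"
      by (simp only: C_def sum_distrib_right)
    finally show "norm (F' ks t) \<le> C * ?S" .
  next
    show "C \<ge> 0" unfolding C_def using \<open>B \<ge> 0\<close> by (intro sum_nonneg mult_nonneg_nonneg) auto
    show "F ks 0 = 0" if "ks \<in> I" for ks
      using zero that y by (simp add: F_def \<gamma>_def I_def)
    show "js \<in> I" using assms(7) by (simp add: I_def)
  qed
  then show ?thesis using z by (simp add: F_def \<gamma>_def v_def)
qed

lemma covtens_diff:
  assumes "\<And>js. length js = k \<Longrightarrow> smooth (\<lambda>x. T x js)" "\<And>js. length js = k \<Longrightarrow> smooth (\<lambda>x. T' x js)"
    and "length js = k" "x \<in> N"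
  shows "covtens j (\<lambda>x js. T x js - T' x js) js x = covtens j T js x - covtens j T' js x"
  using assms by (simp add: covtens_def pd_diff sum_subtractf algebra_simps)

lemma parallel_eq_frame_tensor:
  assumes conv: "convex (chart_map c ` N)"
    and sm: "\<And>js. length js = length is \<Longrightarrow> smooth (\<lambda>x. T x js)"
    and par: "\<And>j js x. length js = length is \<Longrightarrow> x \<in> N \<Longrightarrow> covtens j T js x = 0"
    and y: "y \<in> N" and z: "z \<in> N" and w: "weight is = 0"
    and eq: "\<And>js. length js = length is \<Longrightarrow> T y js = frame_tensor is y js" and "length js = length is"
  shows "T z js = frame_tensor is z js"
proof -
  have "T z js - frame_tensor is z js = 0"
  proof (rule parallel_zero[OF conv _ _ y z, where k = "length is" and T = "\<lambda>x js. T x js - frame_tensor is x js"])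
    show "smooth (\<lambda>x. T x js - frame_tensor is x js)" if "length js = length is" for js
      using sm[OF that] smooth_frame_tensor by (rule smooth_diff)
    show "covtens j (\<lambda>x js. T x js - frame_tensor is x js) js x = 0"
      if "length js = length is" "x \<in> N" for j js x
      using covtens_diff[where T = T and T' = "frame_tensor is", OF sm smooth_frame_tensor that] par[OF that]
      covtens_frame_tensor[OF that(2,1)] w by simp
  qed (use eq assms(8) in auto)
  then show ?thesis by simp
qed

end

section \<open>Pointwise recognition of products of null vectors\<close>

text \<open>The null pair is left existential, so the property ignores scaling and exchange and can
  be carried from point to point and from chart to chart.\<close>

definition is_htensor :: "real ^ 2 ^ 2 \<Rightarrow> sign list \<Rightarrow> (2 list \<Rightarrow> complex) \<Rightarrow> bool" where
  "is_htensor B is t \<longleftrightarrow> (\<exists>k. null_pair B k \<and> (\<forall>js. length js = length is \<longrightarrow> t js = tens k is js))"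

text \<open>The unknown null pair is a reciprocal rescaling of the frame or of its exchange, and at
  weight 0 the scale drops out. So a frame on all of \<open>N\<close> realises the tensor at
  \<open>y\<close>.\<close>

lemma (in null_frame) is_htensorD:
  assumes "is_htensor (g c y) is t" "y \<in> N" "weight is = 0"
  obtains h' where "null_frame c N g h' K"
    "\<And>js. length js = length is \<Longrightarrow> t js = tens (\<lambda>s j. h' s j y) is js"
proof -
  obtain k where k: "null_pair (g c y) k" "\<And>js. length js = length is \<Longrightarrow> t js = tens k is js"
    using assms(1) by (auto simp: is_htensor_def)
  consider u where "u \<noteq> 0" "\<And>j. k Plus j = u * h Plus j y" "\<And>j. k Minus j = inverse u * h Minus j y"
    | u where "u \<noteq> 0" "\<And>j. k Plus j = u * h Minus j y" "\<And>j. k Minus j = inverse u * h Plus j y"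
    using null_pair_unique[OF metric_symmetric[OF assms(2)] null[OF assms(2)] k(1)] by metis
  then show thesis
  proof cases
    case 1
    have "k s j = u powi sval s * h s j y" for s j
      using 1 by (cases s) auto
    then have "tens k is js = tens (\<lambda>s j. h s j y) is js" if "length js = length is" for js
      using tens_scale[OF that, of k u "\<lambda>s j. h s j y"] 1(1) assms(3) by simp
    then show thesis using that[of h] null_frame_axioms k(2) by auto
  next
    case 2
    have "k s j = u powi sval s * h (opp s) j y" for s j
      using 2 by (cases s) auto
    then have "tens k is js = tens (\<lambda>s j. h (opp s) j y) is js" if "length js = length is" for js
      using tens_scale[OF that, of k u "\<lambda>s j. h (opp s) j y"] 2(1) assms(3) by simp
    then show thesis using that[of "\<lambda>s. h (opp s)"] null_frame_opp k(2) by auto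
  qed
qed

lemma (in null_frame) is_htensor_propagates:
  assumes "convex (chart_map c ` N)" "\<And>js. length js = length is \<Longrightarrow> smooth (\<lambda>x. T x js)"
    "\<And>j js x. length js = length is \<Longrightarrow> x \<in> N \<Longrightarrow> covtens j T js x = 0"
    "y \<in> N" "z \<in> N" "weight is = 0" "is_htensor (g c y) is (T y)"
  shows "is_htensor (g c z) is (T z)"
proof -
  obtain h' where h': "null_frame c N g h' K"
    "\<And>js. length js = length is \<Longrightarrow> T y js = tens (\<lambda>s j. h' s j y) is js"
    using is_htensorD[OF assms(7,4,6)] by metis
  interpret h': null_frame c N g h' K by (rule h'(1))
  \<comment> \<open>Being parallel involves only the Christoffel symbols, so it means the same for
    both frames.\<close>
  have "T z js = tens (\<lambda>s j. h' s j z) is js" if "length js = length is" for js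
    by (rule h'.parallel_eq_frame_tensor[OF assms(1) assms(2) _ assms(4-6) h'(2) that])
      (use assms(3) in \<open>auto simp: covtens_def h'.covtens_def Gam_def h'.Gam_def\<close>)
  then show ?thesis using h'.null[OF assms(5)] unfolding is_htensor_def by blast
qed

section \<open>Globalization\<close>

lemma is_chart_open_image:
  assumes "is_chart M c" "openin M N" "N \<subseteq> chart_dom c"
  shows "open (chart_map c ` N)"
proof -
  have "open_map (subtopology M (chart_dom c)) (top_of_set (chart_map c ` chart_dom c)) (chart_map c)"
    using assms(1) homeomorphic_imp_open_map by (auto simp: is_chart_def)
  moreover have "openin (subtopology M (chart_dom c)) N"
    using assms(2,3) by (metis inf.absorb_iff1 openin_subtopology)
  ultimately have "openin (top_of_set (chart_map c ` chart_dom c)) (chart_map c ` N)"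
    by (auto simp: open_map_def)
  moreover have "open (chart_map c ` chart_dom c)" using assms(1) by (simp add: is_chart_def)
  ultimately show ?thesis using openin_open_eq by blast
qed

lemma is_chart_inj:
  assumes "is_chart M c"
  shows "inj_on (chart_map c) (chart_dom c)"
proof -
  have "chart_dom c \<subseteq> topspace M"
    using assms openin_subset by (auto simp: is_chart_def)
  then show ?thesis
    using assms by (auto simp: is_chart_def homeomorphic_eq_everything_map Int_absorb1)
qed

lemma is_chart_openin_preimage:
  assumes "is_chart M c" "open B"
  shows "openin M {x \<in> chart_dom c. chart_map c x \<in> B}"
proof -
  have c: "continuous_map (subtopology M (chart_dom c)) (top_of_set (chart_map c ` chart_dom c)) (chart_map c)"
    and o: "openin M (chart_dom c)"
    using assms(1) by (auto simp: is_chart_def homeomorphic_eq_everything_map)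
  have "openin (subtopology M (chart_dom c)) {x \<in> topspace (subtopology M (chart_dom c)).
      chart_map c x \<in> B \<inter> chart_map c ` chart_dom c}"
    by (rule openin_continuous_map_preimage[OF c]) (use assms(2) in \<open>auto simp: openin_open\<close>)
  then have "openin M {x \<in> topspace (subtopology M (chart_dom c)).
      chart_map c x \<in> B \<inter> chart_map c ` chart_dom c}"
    using o openin_trans_full by blast
  moreover have "{x \<in> topspace (subtopology M (chart_dom c)).
      chart_map c x \<in> B \<inter> chart_map c ` chart_dom c} = {x \<in> chart_dom c. chart_map c x \<in> B}"
    using openin_subset[OF o] by auto
  ultimately show ?thesis by simp
qed

section \<open>A null frame built from the metric coefficients\<close>

lemma gip_2:
  fixes g :: "('a, 2) metric"
  assumes "transpose (g c x) = g c x"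
  shows "gip g c x u v = g c x $ 1 $ 1 * u $ 1 * v $ 1 + g c x $ 1 $ 2 * (u $ 1 * v $ 2 + u $ 2 * v $ 1) +
    g c x $ 2 $ 2 * u $ 2 * v $ 2"
  by (simp add: gip_def sum_2 symmetric_nth[OF assms, of 2 1] algebra_simps)

lemma metric_pos:
  fixes g :: "('a, 2) metric"
  assumes "transpose (g c x) = g c x" "\<And>v. v \<noteq> 0 \<Longrightarrow> gip g c x v v > 0"
  shows "g c x $ 2 $ 2 > 0" "det (g c x) > 0"
proof -
  show d: "g c x $ 2 $ 2 > 0"
  proof -
    have "axis 2 1 \<noteq> (0 :: real ^ 2)" by (simp add: axis_eq_0_iff)
    from assms(2)[OF this] show ?thesis
      by (simp add: gip_2[where g = g and c = c, OF assms(1)] axis_def)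
  qed
  \<comment> \<open>Completing the square: this vector has squared length \<open>g22\<close> times
    the determinant.\<close>
  define v :: "real ^ 2" where "v = vector [g c x $ 2 $ 2, - g c x $ 1 $ 2]"
  have v: "v $ 1 = g c x $ 2 $ 2" "v $ 2 = - g c x $ 1 $ 2"
    by (simp_all add: v_def vector_def)
  then have "v \<noteq> 0" using d by auto
  then have "gip g c x v v > 0" using assms(2) by blast
  moreover have "gip g c x v v = g c x $ 2 $ 2 * det (g c x)"
    by (simp add: gip_2[where g = g and c = c, OF assms(1)] v det_2 symmetric_nth[OF assms(1), of 2 1] algebra_simps)
  ultimately show "det (g c x) > 0"
    using d by (simp add: zero_less_mult_iff)
qed

text \<open>Sectional curvature of the coordinate plane, whose Gram determinant is that of the
  metric.\<close>

lemma curvature_components: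
  fixes g :: "('a, 2) metric"
  assumes "transpose (g c x) = g c x" "det (g c x) \<noteq> 0"
    "\<And>u v. u \<noteq> v \<Longrightarrow> independent {u, v} \<Longrightarrow> sectional_curvature g c x u v = K"
  shows "(\<Sum>l\<in>UNIV. g c x $ l $ 1 * riemann g c x l 1 2 2) = K * det (g c x)"
proof -
  let ?u = "axis 1 1 :: real ^ 2" and ?v = "axis 2 1 :: real ^ 2"
  have "?u \<noteq> ?v" by (simp add: axis_eq_axis)
  moreover have "independent {?u, ?v}"
    by (rule independent_mono[OF independent_Basis]) (auto simp: Basis_vec_def)
  ultimately have "sectional_curvature g c x ?u ?v = K" by (rule assms(3))
  moreover have "gip g c x (curv_op g c x ?u ?v ?v) ?u = (\<Sum>l\<in>UNIV. g c x $ l $ 1 * riemann g c x l 1 2 2)"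
    by (simp add: gip_def curv_op_def sum_2 axis_def)
  moreover have "gip g c x ?u ?u * gip g c x ?v ?v - (gip g c x ?u ?v)\<^sup>2 = det (g c x)"
    by (simp add: gip_2[where g = g and c = c, OF assms(1)] axis_def det_2 symmetric_nth[OF assms(1), of 2 1] power2_eq_square)
  ultimately show ?thesis using assms(2) by (simp add: sectional_curvature_def field_simps)
qed

text \<open>The isotropic direction \<open>(g\<^sub>2\<^sub>2, - g\<^sub>1\<^sub>2 - \<i> \<sigma>)\<close> with \<open>\<sigma>\<^sup>2 = det g\<close>, and its conjugate
  rescaled so that the two pair to \<open>2\<close>.\<close>

definition isotropic :: "('a, 2) metric \<Rightarrow> ('a, 2) chart \<Rightarrow> sign \<Rightarrow> 2 \<Rightarrow> 'a \<Rightarrow> complex" where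
  "isotropic g c s j x = (case s of
     Plus \<Rightarrow> if j = 1 then of_real (g c x $ 2 $ 2)
       else - of_real (g c x $ 1 $ 2) - \<i> * of_real (sqrt (det (g c x)))
   | Minus \<Rightarrow> if j = 1 then of_real (inverse (det (g c x)))
       else (- of_real (g c x $ 1 $ 2) + \<i> * of_real (sqrt (det (g c x)))) *
         of_real (inverse (g c x $ 2 $ 2 * det (g c x))))"

lemma null_pair_isotropic:
  assumes "transpose (g c x) = g c x" "g c x $ 2 $ 2 > 0" "det (g c x) > 0"
  shows "null_pair (g c x) (\<lambda>s j. isotropic g c s j x)"
proof -
  define a b d where "a = complex_of_real (g c x $ 1 $ 1)" and "b = complex_of_real (g c x $ 1 $ 2)"
    and "d = complex_of_real (g c x $ 2 $ 2)"
  define \<sigma> D where "\<sigma> = complex_of_real (sqrt (det (g c x)))" and "D = complex_of_real (det (g c x))"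
  have D: "D = a * d - b * b"
    by (simp add: D_def det_2 a_def b_def d_def symmetric_nth[OF assms(1), of 2 1])
  have \<sigma>: "\<sigma> * \<sigma> = D"
    using assms(3) by (simp add: \<sigma>_def D_def flip: of_real_mult)
  have nz: "D \<noteq> 0" "d \<noteq> 0" using assms by (simp_all add: D_def d_def)
  \<comment> \<open>The \<open>Minus\<close> vector is \<open>w\<close> times the conjugate of the
    \<open>Plus\<close> vector; unscaled they pair to \<open>2 d D\<close>, so this factor
    normalises the pairing to 2.\<close>
  define w where "w = inverse (d * D)"
  have w: "w * (d * D) = 1" using nz by (simp add: w_def field_simps)
  have iso: "isotropic g c Plus 1 x = d" "isotropic g c Plus 2 x = - b - \<i> * \<sigma>"
    "isotropic g c Minus 1 x = d * w" "isotropic g c Minus 2 x = (- b + \<i> * \<sigma>) * w"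
    using nz by (simp_all add: isotropic_def a_def b_def d_def \<sigma>_def D_def w_def)
  have p: "a * d * d + 2 * b * d * (- b - \<i> * \<sigma>) + d * (- b - \<i> * \<sigma>) * (- b - \<i> * \<sigma>) = 0"
  proof -
    have "a * d * d + 2 * b * d * (- b - \<i> * \<sigma>) + d * (- b - \<i> * \<sigma>) * (- b - \<i> * \<sigma>) =
        d * ((a * d - b * b) - \<sigma> * \<sigma>)"
      by (simp add: algebra_simps)
    then show ?thesis using \<sigma> D by simp
  qed
  have m: "a * d * d + 2 * b * d * (- b + \<i> * \<sigma>) + d * (- b + \<i> * \<sigma>) * (- b + \<i> * \<sigma>) = 0"
  proof -
    have "a * d * d + 2 * b * d * (- b + \<i> * \<sigma>) + d * (- b + \<i> * \<sigma>) * (- b + \<i> * \<sigma>) =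
        d * ((a * d - b * b) - \<sigma> * \<sigma>)"
      by (simp add: algebra_simps)
    then show ?thesis using \<sigma> D by simp
  qed
  have pm: "a * d * d + b * d * (- b + \<i> * \<sigma>) + b * (- b - \<i> * \<sigma>) * d +
      d * (- b - \<i> * \<sigma>) * (- b + \<i> * \<sigma>) = 2 * (d * D)"
  proof -
    have "a * d * d + b * d * (- b + \<i> * \<sigma>) + b * (- b - \<i> * \<sigma>) * d +
        d * (- b - \<i> * \<sigma>) * (- b + \<i> * \<sigma>) = d * ((a * d - b * b) + \<sigma> * \<sigma>)"
      by (simp add: algebra_simps)
    then show ?thesis using \<sigma> D by simp
  qed
  have "(\<Sum>i\<in>UNIV. \<Sum>j\<in>UNIV. complex_of_real (g c x $ i $ j) * isotropic g c s i x * isotropic g c s' j x) =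
      (if s = s' then 0 else 2)" for s s'
  proof -
    let ?q = "\<lambda>s s'. a * isotropic g c s 1 x * isotropic g c s' 1 x +
      b * isotropic g c s 1 x * isotropic g c s' 2 x + b * isotropic g c s 2 x * isotropic g c s' 1 x +
      d * isotropic g c s 2 x * isotropic g c s' 2 x"
    have "?q Plus Plus = a * d * d + 2 * b * d * (- b - \<i> * \<sigma>) + d * (- b - \<i> * \<sigma>) * (- b - \<i> * \<sigma>)"
      unfolding iso by (simp add: algebra_simps)
    moreover have "?q Minus Minus =
      (a * d * d + 2 * b * d * (- b + \<i> * \<sigma>) + d * (- b + \<i> * \<sigma>) * (- b + \<i> * \<sigma>)) * w * w"
      unfolding iso by (simp add: algebra_simps)
    moreover have "?q Plus Minus = (a * d * d + b * d * (- b + \<i> * \<sigma>) + b * (- b - \<i> * \<sigma>) * d +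
      d * (- b - \<i> * \<sigma>) * (- b + \<i> * \<sigma>)) * w"
      unfolding iso by (simp add: algebra_simps)
    moreover have "?q Minus Plus = ?q Plus Minus"
      by (simp add: algebra_simps)
    ultimately have q: "?q Plus Plus = 0" "?q Minus Minus = 0" "?q Plus Minus = 2" "?q Minus Plus = 2"
      using p m pm w by (simp_all add: mult_ac)
    have "(\<Sum>i\<in>UNIV. \<Sum>j\<in>UNIV. complex_of_real (g c x $ i $ j) * isotropic g c s i x * isotropic g c s' j x) = ?q s s'"
      by (simp add: sum_2 a_def b_def d_def symmetric_nth[OF assms(1), of 2 1])
    then show ?thesis using q by (cases s; cases s'; simp)
  qed
  then show ?thesis by (simp add: null_pair_def)
qed

lemma riemannian_manifoldD:
  fixes g :: "('a, 'n::finite) metric"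
  assumes "riemannian_manifold M A g"
  shows "c \<in> A \<Longrightarrow> is_chart M c"
    and "(\<Union>c\<in>A. chart_dom c) = topspace M"
    and "c \<in> A \<Longrightarrow> smooth_on (chart_map c ` chart_dom c) (g c \<circ> chart_inv c)"
    and "c \<in> A \<Longrightarrow> x \<in> chart_dom c \<Longrightarrow> transpose (g c x) = g c x"
    and "c \<in> A \<Longrightarrow> x \<in> chart_dom c \<Longrightarrow> v \<noteq> 0 \<Longrightarrow> gip g c x v v > 0"
    and "c \<in> A \<Longrightarrow> c' \<in> A \<Longrightarrow> x \<in> chart_dom c \<inter> chart_dom c' \<Longrightarrow>
      g c x = transpose (jac c c' x) ** g c' x ** jac c c' x"
  using assms unfolding riemannian_manifold_def smooth_manifold_def by (elim conjE; blast)+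

lemma null_frame_isotropic:
  fixes g :: "('a, 2) metric"
  assumes M: "riemannian_manifold M A g" and K: "constant_sectional_curvature A g K"
    and c: "c \<in> A" and N: "openin M N" "N \<subseteq> chart_dom c"
  shows "null_frame c N g (isotropic g c) K"
proof -
  have chart: "is_chart M c"
    by (rule riemannian_manifoldD(1)[OF M c])
  interpret chart_nbhd c N
    using is_chart_inj[OF chart] is_chart_open_image[OF chart N] N(2) by unfold_locales
  have sym: "transpose (g c x) = g c x" if "x \<in> N" for x
    using riemannian_manifoldD(4)[OF M c] N(2) that by blast
  have pos: "g c x $ 2 $ 2 > 0" "det (g c x) > 0" if "x \<in> N" for x
    using metric_pos[where g = g and c = c, OF sym[OF that] riemannian_manifoldD(5)[OF M c]] N(2) that
    by blast+
  have sm: "smooth (\<lambda>x. g c x $ i $ j)" for i j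
  proof -
    have "smooth_on (chart_map c ` N) (g c \<circ> chart_inv c)"
      by (rule smooth_on_subset[OF image_mono[OF N(2)] riemannian_manifoldD(3)[OF M c]])
    then have "smooth (g c)" by (simp add: smooth_def)
    then show ?thesis
      by (rule smooth_bounded_linear[OF bounded_linear_compose[OF bounded_linear_vec_nth bounded_linear_vec_nth]])
  qed
  have det: "smooth (\<lambda>x. det (g c x))"
    unfolding det_2 by (intro smooth_diff smooth_mult sm)
  show ?thesis
  proof
    show "smooth (isotropic g c s i)" for s i
    proof -
      have 1: "smooth (\<lambda>x. complex_of_real (g c x $ i $ j))" for i j
        by (rule smooth_of_real[OF sm])
      have 2: "smooth (\<lambda>x. complex_of_real (sqrt (det (g c x))))"
        by (intro smooth_of_real smooth_sqrt det pos)
      have 3: "smooth (\<lambda>x. complex_of_real (inverse (det (g c x))))"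
        using pos by (intro smooth_of_real smooth_inverse det) (auto simp: less_imp_neq[symmetric])
      have 4: "smooth (\<lambda>x. complex_of_real (inverse (g c x $ 2 $ 2 * det (g c x))))"
        using pos by (intro smooth_of_real smooth_inverse smooth_mult det sm) force
      show ?thesis
        unfolding isotropic_def using 1 2 3 4
        by (cases s; cases "i = 1") (auto intro!: smooth_mult smooth_add smooth_diff smooth_minus)
    qed
    show "null_pair (g c x) (\<lambda>s j. isotropic g c s j x)" if "x \<in> N" for x
      by (rule null_pair_isotropic[where g = g and c = c, OF sym pos]) (fact that)+
    show "(\<Sum>l\<in>UNIV. g c x $ l $ 1 * riemann g c x l 1 2 2) = K * det (g c x)" if "x \<in> N" for x
      using K c N(2) that pos[OF that]
      by (intro curvature_components[where g = g and c = c, OF sym[OF that]]) (auto simp: constant_sectional_curvature_def)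
  qed (use sym sm in auto)
qed

section \<open>The global parallel section is everywhere a product of null vectors\<close>

text \<open>Push the null pair forward by \<open>J\<close>: the congruence between \<open>B\<close>
  and \<open>B'\<close> preserves all pairings.\<close>

lemma is_htensor_transform:
  fixes J :: "real ^ 2 ^ 2"
  assumes "is_htensor B is t" and B: "B = transpose J ** B' ** J"
    and t': "\<And>js. length js = length is \<Longrightarrow>
      t' js = (\<Sum>ks | length ks = length is. (\<Prod>m<length is. of_real (J $ (js ! m) $ (ks ! m))) * t ks)"
  shows "is_htensor B' is t'"
proof -
  obtain k where k: "null_pair B k" "\<And>js. length js = length is \<Longrightarrow> t js = tens k is js"
    using assms(1) by (auto simp: is_htensor_def)
  define k' where "k' s a = (\<Sum>b\<in>UNIV. of_real (J $ a $ b) * k s b)" for s a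
  have "null_pair B' k'"
    unfolding null_pair_def
  proof (intro allI)
    fix s s'
    have "(\<Sum>i\<in>UNIV. \<Sum>j\<in>UNIV. of_real (B' $ i $ j) * k' s i * k' s' j) =
        (\<Sum>i\<in>UNIV. \<Sum>j\<in>UNIV. of_real (B $ i $ j) * k s i * k s' j)"
      unfolding B k'_def by (simp add: matrix_matrix_mult_def transpose_def sum_2 algebra_simps)
    then show "(\<Sum>i\<in>UNIV. \<Sum>j\<in>UNIV. of_real (B' $ i $ j) * k' s i * k' s' j) =
        (if s = s' then 0 else 2)"
      using k(1) by (simp add: null_pair_def)
  qed
  moreover have "t' js = tens k' is js" if "length js = length is" for js
  proof -
    have "t' js = (\<Sum>ks | length ks = length is. \<Prod>m<length is. of_real (J $ (js ! m) $ (ks ! m)) * k (is ! m) (ks ! m))"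
      unfolding t'[OF that] by (intro sum.cong refl) (simp add: k(2) tens_def prod.distrib)
    also have "\<dots> = tens k' is js"
      unfolding tens_def k'_def by (rule prod_sum_lists[symmetric])
    finally show ?thesis .
  qed
  ultimately show ?thesis unfolding is_htensor_def by blast
qed

lemma is_htensor_change_chart:
  fixes g :: "('a, 2) metric"
  assumes M: "riemannian_manifold M A g" and S: "smooth_section A (length is) S"
    and c: "c \<in> A" "c' \<in> A" "x \<in> chart_dom c \<inter> chart_dom c'"
    and h: "is_htensor (g c x) is (S c x)"
  shows "is_htensor (g c' x) is (S c' x)"
proof (rule is_htensor_transform[OF h])
  show "g c x = transpose (jac c c' x) ** g c' x ** jac c c' x"
    by (rule riemannian_manifoldD(6)[OF M c])
  show "S c' x js = (\<Sum>ks | length ks = length is.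
      (\<Prod>m<length is. of_real (jac c c' x $ (js ! m) $ (ks ! m))) * S c x ks)"
    if "length js = length is" for js
    using S c that unfolding smooth_section_def by blast
qed

lemma is_htensor_base:
  fixes g :: "('a, 2) metric"
  assumes M: "riemannian_manifold M A g" and e: "orthonormal_basis A g p e"
    and S: "parallel_extension A g p e is S" and c: "c \<in> A" "p \<in> chart_dom c"
  shows "is_htensor (g c p) is (S c p)"
proof -
  have e': "gip g c p (e i c) (e j c) = (if i = j then 1 else 0)" for i j
    using e c by (simp add: orthonormal_basis_def)
  have "null_pair (g c p) (\<lambda>s j. hvec e s c $ j)"
    unfolding null_pair_def
  proof (intro allI)
    fix s s'
    let ?q = "\<lambda>i j. complex_of_real (gip g c p (e i c) (e j c))"
    \<comment> \<open>The coefficient of \<open>e 2\<close> in \<open>hvec e s c\<close>. By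
      orthonormality the pairing becomes \<open>1 + z * z'\<close>, and \<open>z * z'\<close> is -1
      for equal signs and 1 for opposite ones.\<close>
    define z where "z = (case s of Plus \<Rightarrow> - \<i> | Minus \<Rightarrow> \<i>)"
    define z' where "z' = (case s' of Plus \<Rightarrow> - \<i> | Minus \<Rightarrow> \<i>)"
    have hv: "hvec e s c $ j = of_real (e 1 c $ j) + z * of_real (e 2 c $ j)"
      "hvec e s' c $ j = of_real (e 1 c $ j) + z' * of_real (e 2 c $ j)" for j
      by (auto simp: hvec_def z_def z'_def split: sign.split)
    have "(\<Sum>i\<in>UNIV. \<Sum>j\<in>UNIV. of_real (g c p $ i $ j) * hvec e s c $ i * hvec e s' c $ j) =
        ?q 1 1 + z' * ?q 1 2 + z * ?q 2 1 + z * z' * ?q 2 2"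
      unfolding hv gip_def by (simp add: sum_2 algebra_simps)
    also have "\<dots> = 1 + z * z'" by (simp add: e')
    also have "\<dots> = (if s = s' then 0 else 2)"
      by (cases s; cases s') (auto simp: z_def z'_def)
    finally show "(\<Sum>i\<in>UNIV. \<Sum>j\<in>UNIV. of_real (g c p $ i $ j) * hvec e s c $ i * hvec e s' c $ j) =
        (if s = s' then 0 else 2)" .
  qed
  moreover have "S c p js = tens (\<lambda>s j. hvec e s c $ j) is js" if "length js = length is" for js
    using S c that by (simp add: parallel_extension_def htensor_def tens_def)
  ultimately show ?thesis unfolding is_htensor_def by blast
qed

text \<open>Since \<open>u\<close> and \<open>v\<close> range over the same neighbourhood,
  \<open>P\<close> is locally constant, so the set where it holds is open and closed.\<close>

lemma connected_space_induct:
  assumes "connected_space M" "p \<in> topspace M" "P p" "x \<in> topspace M"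
    and loc: "\<And>y. y \<in> topspace M \<Longrightarrow>
      \<exists>N. openin M N \<and> y \<in> N \<and> (\<forall>u\<in>N. \<forall>v\<in>N. P u \<longrightarrow> P v)"
  shows "P x"
proof -
  let ?X = "{y \<in> topspace M. P y}" and ?Y = "{y \<in> topspace M. \<not> P y}"
  have sub: "N \<subseteq> topspace M" if "openin M N" for N using openin_subset[OF that] .
  have "\<exists>N. openin M N \<and> y \<in> N \<and> N \<subseteq> ?X" if "y \<in> ?X" for y
    using loc[of y] that sub by blast
  then have "openin M ?X" by (subst openin_subopen) blast
  moreover have "\<exists>N. openin M N \<and> y \<in> N \<and> N \<subseteq> ?Y" if "y \<in> ?Y" for y
    using loc[of y] that sub by blast
  then have "openin M ?Y" by (subst openin_subopen) blast
  moreover have "topspace M - ?X = ?Y" by auto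
  ultimately have "openin M ?X \<and> closedin M ?X" by (simp add: closedin_def)
  then have "?X = {} \<or> ?X = topspace M"
    using assms(1) unfolding connected_space_clopen_in by blast
  then show ?thesis using assms(2-4) by blast
qed

lemma parallel_extension_is_htensor:
  fixes g :: "('a, 2) metric"
  assumes M: "riemannian_manifold M A g" and K: "constant_sectional_curvature A g K"
    and conn: "connected_space M" and p: "p \<in> topspace M" and e: "orthonormal_basis A g p e"
    and S: "parallel_extension A g p e is S" and w: "weight is = 0"
    and c: "c \<in> A" "x \<in> chart_dom c"
  shows "is_htensor (g c x) is (S c x)"
proof -
  \<comment> \<open>Quantifying over charts makes this a property of the point alone; by
    \<open>P_iff\<close> one chart decides it.\<close>
  define P where "P x \<longleftrightarrow> (\<forall>c\<in>A. x \<in> chart_dom c \<longrightarrow> is_htensor (g c x) is (S c x))" for x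
  note charts = riemannian_manifoldD(1)[OF M]
  have cover: "\<exists>c\<in>A. x \<in> chart_dom c" if "x \<in> topspace M" for x
    using riemannian_manifoldD(2)[OF M] that by blast
  have sec: "smooth_section A (length is) S" and par: "parallel_section A g (length is) S"
    using S by (simp_all add: parallel_extension_def parallel_section_def)
  have P_iff: "P y \<longleftrightarrow> is_htensor (g c y) is (S c y)" if "c \<in> A" "y \<in> chart_dom c" for c y
    using is_htensor_change_chart[OF M sec that(1) _ _] that unfolding P_def by blast
  have "P x"
  proof (rule connected_space_induct[OF conn p])
    show "P p" unfolding P_def using is_htensor_base[OF M e S] by blast
    show "x \<in> topspace M"
      using c charts openin_subset by (fastforce simp: is_chart_def)
    fix y assume "y \<in> topspace M"
    then obtain c where c: "c \<in> A" "y \<in> chart_dom c" using cover by blast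
    note chart = charts[OF c(1)]
    have "open (chart_map c ` chart_dom c)" using chart by (simp add: is_chart_def)
    then obtain \<epsilon> where \<epsilon>: "\<epsilon> > 0" "ball (chart_map c y) \<epsilon> \<subseteq> chart_map c ` chart_dom c"
      using c(2) openE by blast
    \<comment> \<open>A coordinate ball, because propagation runs along straight segments and
      requires a convex image.\<close>
    define N where "N = {x \<in> chart_dom c. chart_map c x \<in> ball (chart_map c y) \<epsilon>}"
    have N: "openin M N" "N \<subseteq> chart_dom c" "y \<in> N"
      using is_chart_openin_preimage[OF chart open_ball] c(2) \<epsilon>(1) by (auto simp: N_def)
    have img: "chart_map c ` N = ball (chart_map c y) \<epsilon>" using \<epsilon>(2) by (auto simp: N_def)
    interpret null_frame c N g "isotropic g c" K
      by (rule null_frame_isotropic[OF M K c(1) N(1,2)])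
    have "P v" if uv: "u \<in> N" "v \<in> N" "P u" for u v
    proof -
      have "is_htensor (g c v) is (S c v)"
      proof (rule is_htensor_propagates[OF _ _ _ uv(1,2) w])
        show "convex (chart_map c ` N)" by (simp add: img)
        show "smooth (\<lambda>x. S c x js)" if "length js = length is" for js
          using sec c(1) that N(2) unfolding smooth_section_def smooth_def
          by (auto intro: smooth_on_subset[OF image_mono])
        show "covtens j (S c) js x = 0" if "length js = length is" "x \<in> N" for j js x
          using par c(1) that N(2) by (auto simp: parallel_section_def covtens_def Gam_def)
        show "is_htensor (g c u) is (S c u)" using P_iff[OF c(1), of u] uv N(2) by blast
      qed
      then show "P v" using P_iff[OF c(1), of v] uv N(2) by blast
    qed
    then show "\<exists>N. openin M N \<and> y \<in> N \<and> (\<forall>u\<in>N. \<forall>v\<in>N. P u \<longrightarrow> P v)"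
      using N by blast
  qed
  then show ?thesis using c by (simp add: P_def)
qed

section \<open>Assembly of the polynomial identity and its roots\<close>

theorem proposition4p4:
  fixes M :: "'a topology" and A :: "('a, 2) chart set" and g :: "('a, 2) metric"
    and K :: real and p :: 'a and e :: "2 \<Rightarrow> ('a, 2) tvec"
    and r :: nat and i :: "sign list" and S :: "('a, 2) ctensor_field"
  assumes "riemannian_manifold M A g"
    and "connected_space M" and "complete_manifold M A g" and "orientable M A"
    and "constant_sectional_curvature A g K" and "K \<noteq> 0"
    and "p \<in> topspace M" and "orthonormal_basis A g p e"
    and "r \<ge> 1" and "length i = 2 * r"
    and "count_list i Plus = r" and "count_list i Minus = r"
    and "parallel_extension A g p e i S"
  shows "\<exists>P :: complex poly.
    (\<forall>U \<mu> f. openin M U \<and> eigenfunction A g U \<mu> f \<longrightarrow>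
       (\<forall>c\<in>A. \<forall>x\<in>chart_dom c \<inter> U.
          contract (2 * r) (nabla_fun g c (2 * r) f x) (S c x) = poly P \<mu> * f x)) \<and>
    {z. poly P z = 0} \<subseteq> {of_nat q * (of_nat q - 1) * of_real K | q. q \<in> {1..r}} \<and>
    (\<forall>t\<in>{1..2 * r}. (\<forall>j\<in>{2 * r - t..<2 * r}. i ! j = i ! (2 * r - 1)) \<longrightarrow>
       (\<forall>q\<in>{1..t}. poly P (of_nat q * (of_nat q - 1) * of_real K) = 0))"
\<comment> \<open>The witness is \<open>eig_poly K i\<close>, which depends only on the curvature
  and the word and thus serves every \<open>U\<close>, \<mu> and \<open>f\<close>.\<close>
proof (intro exI conjI)
  have w: "weight i = 0" using assms(11,12) by (simp add: weight_count)
  show "\<forall>U \<mu> f. openin M U \<and> eigenfunction A g U \<mu> f \<longrightarrow>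
       (\<forall>c\<in>A. \<forall>x\<in>chart_dom c \<inter> U.
          contract (2 * r) (nabla_fun g c (2 * r) f x) (S c x) = poly (eig_poly K i) \<mu> * f x)"
  proof (intro allI impI ballI, elim conjE)
    fix U \<mu> f c x
    assume U: "openin M U" and f: "eigenfunction A g U \<mu> f" and c: "c \<in> A" and x: "x \<in> chart_dom c \<inter> U"
    define N where "N = chart_dom c \<inter> U"
    have "openin M (chart_dom c)"
      using riemannian_manifoldD(1)[OF assms(1) c] by (simp add: is_chart_def)
    then have N: "openin M N" "N \<subseteq> chart_dom c" "x \<in> N"
      using U x by (auto simp: N_def)
    interpret iso: null_frame c N g "isotropic g c" K
      by (rule null_frame_isotropic[OF assms(1,5) c N(1,2)])
    have "is_htensor (g c x) i (S c x)"
      using parallel_extension_is_htensor[OF assms(1,5,2,7,8,13) w c] x by blast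
    \<comment> \<open>The frame may vary with \<open>x\<close>; the polynomial does not.\<close>
    then obtain h where h: "null_frame c N g h K"
      "\<And>js. length js = length i \<Longrightarrow> S c x js = tens (\<lambda>s j. h s j x) i js"
      using iso.is_htensorD[OF _ N(3) w] by blast
    interpret null_frame c N g h K by (rule h(1))
    have "contract (2 * r) (nabla_fun g c (2 * r) f x) (S c x) =
        contract (length i) (nabla_fun g c (length i) f x) (tens (\<lambda>s j. h s j x) i)"
      unfolding contract_def assms(10) by (intro sum.cong refl) (simp add: h(2) assms(10))
    also have "\<dots> = poly (eig_poly K i) \<mu> * f x"
    proof (rule contract_nabla[OF _ _ N(3) w])
      \<comment> \<open>Smoothness refers only to \<open>c\<close> and \<open>N\<close>, hence is
        the same notion for both frames.\<close>
      show "iso.smooth f"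
        using f c unfolding iso.smooth_def unfolding eigenfunction_def smooth_fun_on_def N_def by blast
      show "- laplacian g c f x = \<mu> * f x" if "x \<in> N" for x
        using f c that by (simp add: eigenfunction_def N_def)
    qed
    finally show "contract (2 * r) (nabla_fun g c (2 * r) f x) (S c x) = poly (eig_poly K i) \<mu> * f x" .
  qed
  show "{z. poly (eig_poly K i) z = 0} \<subseteq> {of_nat q * (of_nat q - 1) * of_real K | q. q \<in> {1..r}}"
  proof safe
    fix z assume "poly (eig_poly K i) z = 0"
    then show "\<exists>q. z = of_nat q * (of_nat q - 1) * of_real K \<and> q \<in> {1..r}"
      using eig_poly_roots[of K i z r] assms(11,12) by auto
  qed
  show "\<forall>t\<in>{1..2 * r}. (\<forall>j\<in>{2 * r - t..<2 * r}. i ! j = i ! (2 * r - 1)) \<longrightarrow>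
       (\<forall>q\<in>{1..t}. poly (eig_poly K i) (of_nat q * (of_nat q - 1) * of_real K) = 0)"
  proof (intro ballI impI)
    fix t q
    assume t: "t \<in> {1..2 * r}" "\<forall>j\<in>{2 * r - t..<2 * r}. i ! j = i ! (2 * r - 1)" and q: "q \<in> {1..t}"
    define s where "s = i ! (2 * r - 1)"
    have "drop (2 * r - t) i = replicate t s"
    proof (rule nth_equalityI)
      show "length (drop (2 * r - t) i) = length (replicate t s)"
        using t(1) assms(10) by simp
      fix m assume "m < length (drop (2 * r - t) i)"
      then have "m < t" "2 * r - t + m \<in> {2 * r - t..<2 * r}"
        using t(1) assms(10) by auto
      with t(2) show "drop (2 * r - t) i ! m = replicate t s ! m"
        by (simp only: nth_drop assms(10) diff_le_self nth_replicate s_def)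
    qed
    then have i: "take (2 * r - t) i @ replicate t s = i"
      using append_take_drop_id[of "2 * r - t" i] by (simp only:)
    \<comment> \<open>The final run of \<open>t\<close> equal letters has weight \<open>t\<close> or
      \<open>- t\<close>, while the whole word has weight 0, so the weight must descend from
      \<open>q\<close> to \<open>q - 1\<close> in absolute value.\<close>
    have "int q \<le> \<bar>weight (replicate t s)\<bar>" using q by (cases s) auto
    moreover have "\<bar>weight (take (2 * r - t) i @ replicate t s)\<bar> < int q"
      unfolding i using w q by simp
    ultimately have "poly (eig_poly K (take (2 * r - t) i @ replicate t s))
        (of_nat q * (of_nat q - 1) * of_real K) = 0"
      by (rule eig_poly_descent)
    then show "poly (eig_poly K i) (of_nat q * (of_nat q - 1) * of_real K) = 0"
      unfolding i .
  qed
qed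

end
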